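(* Consider a well-behaved exponential family with conjugate prior $\pi_{\xi,\nu}$, with sufficient statistics function $s:\mathcal{X}\to\mathbb{R}^k$ and moment space $\mathcal{M}$, along with the resulting collection of single-cluster marginals $m(\cdot)$. Let $P$ be a probability measure on $\mathcal{X}$ such that, when $X\sim P$, (1) $\mathbb{E}|s(X)|<\infty$, (2) $\mathbb{P}(s(X)\in\overline{\mathcal{M}})=1$, and (3) $\mathbb{P}(s(X)\in L)=0$ for any hyperplane $L\subset\mathbb{R}^k$ that does not intersect $\mathcal{M}$. Let $X_1,X_2,\dots$ be i.i.d. with distribution $P$. Then for any $t\in\{1,2,\dots\}$, $$\sup_{c\in[0,\infty)}\liminf_{n\to\infty}\phi_t(X_{1:n},c)>0\quad\text{with probability }1.$$
   Context: **Well-behaved exponential family with conjugate prior.** Fix a sigma-finite Borel measure $\lambda$ on $\mathcal{X}\subset\mathbb{R}^d$ with $\lambda(\mathcal{X})\ne0$ and a Borel measurable $s:\mathcal{X}\to\mathbb{R}^k$. For $\theta\in\Theta\subset\mathbb{R}^k$ let $p_\theta(x)=\exp(\theta^{\mathsf T}s(x)-\kappa(\theta))$ with $\kappa(\theta)=\log\int_{\mathcal{X}}\exp(\theta^{\mathsf T}s(x))\,d\lambda(x)$, and let $P_\theta$ be the probability measure with density $p_\theta$ with respect to $\lambda$. Assume: $\Theta=\{\theta\in\mathbb{R}^k:\kappa(\theta)<\infty\}$; $\Theta\ne\varnothing$; $\Theta$ is open in $\mathbb{R}^k$; and $\theta\ne\theta'$ implies $P_\theta\ne P_{\theta'}$.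 The moment space is $\mathcal{M}=\{\mathbb{E}_\theta s(X):\theta\in\Theta\}\subset\mathbb{R}^k$. The prior is $$\pi_{\xi,\nu}(\theta)=\exp\big(\xi^{\mathsf T}\theta-\nu\kappa(\theta)-\psi(\xi,\nu)\big)I(\theta\in\Theta),\qquad\psi(\xi,\nu)=\log\int_\Theta\exp(\xi^{\mathsf T}\theta-\nu\kappa(\theta))\,d\theta,$$ a density with respect to Lebesgue measure on $\mathbb{R}^k$, where $\xi\in\mathbb{R}^k$, $\nu>0$ and $\xi/\nu\in\mathcal{M}$. $|\cdot|$ is the Euclidean norm, $\overline{\mathcal{M}}$ the closure of $\mathcal{M}$. A hyperplane is a set $\{x\in\mathbb{R}^k:x^{\mathsf T}y=b\}$ with $y\in\mathbb{R}^k\smallsetminus\{0\}$, $b\in\mathbb{R}$. **Marginals.** For $J\subset\{1,\dots,n\}$ and $x_J=(x_j:j\in J)$, $m(x_J)=\int_\Theta\big(\prod_{j\in J}p_\theta(x_j)\big)\pi_{\xi,\nu}(\theta)\,d\theta$, assumed finite, with $m(x_\varnothing)=1$. **The function $\phi_t$.** For $1\le t\le n$, $\mathcal{A}_t(n)$ is the set of ordered partitions $A=(A_1,\dots,A_t)$ of $\{1,\dots,n\}$ into $t$ nonempty disjoint sets (parts). For $c\in[0,\infty)$, $\phi_t(x_{1:n},c)=\min_{A\in\mathcal{A}_t(n)}\frac1n|S_A(x_{1:n},c)|$, where $S_A(x_{1:n},c)$ is the set of $j\in\{1,\dots,n\}$ such that the part $A_\ell$ containing $j$ satisfies $m(x_{A_\ell})\le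 c\,m(x_{A_\ell\smallsetminus\{j\}})\,m(x_j)$. *)

theory Defs
  imports "HOL-Probability.Probability"
begin

text \<open>
  Throughout, \<open>lam\<close> is a measure whose space is the sample space and \<open>s\<close> is the
  sufficient statistics function.
\<close>

definition log_ext :: "ennreal \<Rightarrow> ereal" where
  "log_ext z = (if z = 0 then -\<infinity> else if z = \<infinity> then \<infinity> else ereal (ln (enn2real z)))"

definition kappa_ext :: "'x measure \<Rightarrow> ('x \<Rightarrow> real^'k) \<Rightarrow> real^'k \<Rightarrow> ereal" where
  "kappa_ext lam s \<theta> = log_ext (\<integral>\<^sup>+ x. ennreal (exp (\<theta> \<bullet> s x)) \<partial>lam)"

definition Theta :: "'x measure \<Rightarrow> ('x \<Rightarrow> real^'k) \<Rightarrow> (real^'k) set" where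
  "Theta lam s = {\<theta>. kappa_ext lam s \<theta> < \<infinity>}"

text \<open>The value of \<open>kappa\<close> outside \<open>Theta\<close> is arbitrary and never used below.\<close>

definition kappa :: "'x measure \<Rightarrow> ('x \<Rightarrow> real^'k) \<Rightarrow> real^'k \<Rightarrow> real" where
  "kappa lam s \<theta> = real_of_ereal (kappa_ext lam s \<theta>)"

definition expfam_density :: "'x measure \<Rightarrow> ('x \<Rightarrow> real^'k) \<Rightarrow> real^'k \<Rightarrow> 'x \<Rightarrow> real" where
  "expfam_density lam s \<theta> x = exp (\<theta> \<bullet> s x - kappa lam s \<theta>)"

definition expfam_measure :: "'x measure \<Rightarrow> ('x \<Rightarrow> real^'k) \<Rightarrow> real^'k \<Rightarrow> 'x measure" where
  "expfam_measure lam s \<theta> = density lam (\<lambda>x. ennreal (expfam_density lam s \<theta> x))"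

definition moment_space :: "'x measure \<Rightarrow> ('x \<Rightarrow> real^'k) \<Rightarrow> (real^'k) set" where
  "moment_space lam s = (\<lambda>\<theta>. \<integral>x. s x \<partial>expfam_measure lam s \<theta>) ` Theta lam s"

definition well_behaved_expfam ::
    "(real^'d) set \<Rightarrow> (real^'d) measure \<Rightarrow> (real^'d \<Rightarrow> real^'k) \<Rightarrow> bool" where
  "well_behaved_expfam XX lam s \<longleftrightarrow>
     sets lam = sets (restrict_space borel XX) \<and>
     sigma_finite_measure lam \<and>
     emeasure lam XX \<noteq> 0 \<and>
     s \<in> borel_measurable lam \<and>
     Theta lam s \<noteq> {} \<and>
     open (Theta lam s) \<and>
     (\<forall>\<theta>\<in>Theta lam s. \<forall>\<theta>'\<in>Theta lam s. \<theta> \<noteq> \<theta>' \<longrightarrow>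
        expfam_measure lam s \<theta> \<noteq> expfam_measure lam s \<theta>')"

text \<open>
  For \<open>\<nu> > 0\<close> and \<open>\<xi> / \<nu>\<close> in the moment space the integral defining \<open>psi\<close> is
  positive and finite, so that the conversion from \<open>ereal\<close> is harmless.
\<close>

definition psi :: "'x measure \<Rightarrow> ('x \<Rightarrow> real^'k) \<Rightarrow> real^'k \<Rightarrow> real \<Rightarrow> real" where
  "psi lam s \<xi> \<nu> = real_of_ereal (log_ext
     (\<integral>\<^sup>+ \<theta>\<in>Theta lam s. ennreal (exp (\<xi> \<bullet> \<theta> - \<nu> * kappa lam s \<theta>)) \<partial>lborel))"

definition conj_prior ::
    "'x measure \<Rightarrow> ('x \<Rightarrow> real^'k) \<Rightarrow> real^'k \<Rightarrow> real \<Rightarrow> real^'k \<Rightarrow> real" where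
  "conj_prior lam s \<xi> \<nu> \<theta> =
     exp (\<xi> \<bullet> \<theta> - \<nu> * kappa lam s \<theta> - psi lam s \<xi> \<nu>) * indicator (Theta lam s) \<theta>"

text \<open>
  \<open>marginal lam s \<xi> \<nu> x J\<close> is \<open>m(x\<^sub>J)\<close>; only the values of the sequence \<open>x\<close> at the
  indices in \<open>J\<close> matter.
\<close>

definition marginal ::
    "'x measure \<Rightarrow> ('x \<Rightarrow> real^'k) \<Rightarrow> real^'k \<Rightarrow> real \<Rightarrow> (nat \<Rightarrow> 'x) \<Rightarrow> nat set \<Rightarrow> ennreal" where
  "marginal lam s \<xi> \<nu> x J =
     (if J = {} then 1
      else \<integral>\<^sup>+ \<theta>\<in>Theta lam s.
             ennreal ((\<Prod>j\<in>J. expfam_density lam s \<theta> (x j)) * conj_prior lam s \<xi> \<nu> \<theta>) \<partial>lborel)"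

definition ordered_partitions :: "nat \<Rightarrow> nat \<Rightarrow> (nat \<Rightarrow> nat set) set" where
  "ordered_partitions t n =
     {A \<in> {1..t} \<rightarrow>\<^sub>E Pow {1..n}.
        (\<forall>l\<in>{1..t}. A l \<noteq> {}) \<and> disjoint_family_on A {1..t} \<and> (\<Union>l\<in>{1..t}. A l) = {1..n}}"

text \<open>The argument \<open>m\<close> below stands for the map \<open>J \<mapsto> m(x\<^sub>J)\<close>.\<close>

definition S_set ::
    "(nat set \<Rightarrow> ennreal) \<Rightarrow> nat \<Rightarrow> nat \<Rightarrow> (nat \<Rightarrow> nat set) \<Rightarrow> real \<Rightarrow> nat set" where
  "S_set m t n A c =
     {j \<in> {1..n}. \<exists>l\<in>{1..t}. j \<in> A l \<and> m (A l) \<le> ennreal c * m (A l - {j}) * m {j}}"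

text \<open>
  For \<open>n < t\<close> there are no ordered partitions and the minimum is an unspecified number;
  this does not affect the behaviour as \<open>n\<close> tends to infinity.
\<close>

definition phi :: "(nat set \<Rightarrow> ennreal) \<Rightarrow> nat \<Rightarrow> nat \<Rightarrow> real \<Rightarrow> real" where
  "phi m t n c = Min ((\<lambda>A. real (card (S_set m t n A c)) / real n) ` ordered_partitions t n)"

definition hyperplane :: "(real^'k) set \<Rightarrow> bool" where
  "hyperplane L \<longleftrightarrow> (\<exists>y b. y \<noteq> 0 \<and> L = {x. x \<bullet> y = b})"

end

theory Submission
  imports Defs
begin

text \<open>
  Let \<open>Y\<^sub>j = s(X\<^sub>j)\<close>. For a unit vector \<open>u\<close> put \<open>h = sup {m \<bullet> u | m \<in> M}\<close>. By identifiability
  this supremum is not attained, so the hyperplane \<open>y \<bullet> u = h\<close> misses the moment space \<open>M\<close> and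
  \<open>Y \<bullet> u < h\<close> almost surely. A law of large numbers for the nonnegative part of \<open>Y \<bullet> u - m \<bullet> u + d\<close>
  and compactness of the sphere give finitely many moments \<open>m\<close> and some \<open>a > 0\<close> such that, for large \<open>n\<close>
  and simultaneously for all \<open>J \<subseteq> {1..n}\<close> with \<open>|J| \<ge> n / t\<close>, every direction \<open>u\<close> has one of these
  \<open>m\<close> exceeding the mean of the \<open>Y\<^sub>j\<close>, \<open>j \<in> J\<close>, by at least \<open>a\<close> in direction \<open>u\<close>.

  Convexity gives \<open>\<kappa>(\<theta>) \<ge> m \<bullet> \<theta> - C\<close> for each of these \<open>m\<close>. Hence the posterior given \<open>X\<^sub>J\<close> decays
  exponentially in \<open>|J| |\<theta>|\<close> and puts at least half of its mass on a fixed ball. There \<open>p\<^sub>\<theta>(X\<^sub>j)\<close> is bounded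
  above if \<open>|Y\<^sub>j| \<le> R\<close>, while \<open>m(X\<^sub>j)\<close> is bounded below, so that such \<open>j \<in> J\<close> satisfy
  \<open>m(X\<^sub>J) \<le> c m(X\<^bsub>J - {j}\<^esub>) m(X\<^sub>j)\<close>. Every partition into \<open>t\<close> parts has a part with at least
  \<open>n / t\<close> elements, and \<open>R\<close> is chosen such that at most \<open>n / (2 t)\<close> indices violate \<open>|Y\<^sub>j| \<le> R\<close>.
\<close>

section \<open>A one-sided law of large numbers\<close>

text \<open>Levels with \<open>2^k < a\<close> contribute \<open>2^k\<close> each, a geometric sum
  of at most \<open>2 * a\<close>; the others contribute \<open>a\<^sup>2 / 2^k\<close>, a geometric
  tail of at most \<open>2 * a\<close>.\<close>

lemma sum_min_power2_le:
  fixes a :: real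
  assumes "a \<ge> 0"
  shows "(\<Sum>k<K. (min a (2^k))\<^sup>2 / 2^k) \<le> 4 * a"
proof -
  have "(\<Sum>k<K. (min a (2^k))\<^sup>2 / 2^k) \<le>
      (if 2^K < a then 2^K - 1 else 4 * a - 2 * a\<^sup>2 / 2^K)" for K
  proof (induction K)
    case 0
    have "a * a \<le> a * 1" if "a \<le> 1"
      using that assms by (intro mult_left_mono) auto
    then show ?case using assms by (auto simp: power2_eq_square)
  next
    case (Suc K)
    show ?case
    proof (cases "2^K < a")
      case True
      have "2 * a\<^sup>2 / 2^(Suc K) \<le> 2 * a" if "\<not> 2^(Suc K) < a"
        using that assms mult_left_mono[of a "2 * 2^K" a]
        by (auto simp: power2_eq_square divide_simps)
      moreover have "(\<Sum>k<K. (min a (2^k))\<^sup>2 / 2^k) + (min a (2^K))\<^sup>2 / 2^K \<le> 2^(Suc K) - 1"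
        using True Suc by (simp add: power2_eq_square)
      ultimately show ?thesis using True by (auto simp del: power_Suc) (simp_all)
    next
      case False
      then have "\<not> 2^(Suc K) < a" using assms by (auto intro: order_trans[of a "2^K"] simp: not_less)
      with False Suc show ?thesis by (simp add: divide_simps)
    qed
  qed
  from this[of K] show ?thesis
    using assms by (auto split: if_splits intro: order_trans)
qed

text \<open>After expanding the square, independence and centring annihilate the off-diagonal
  products; boundedness makes all products integrable.\<close>

lemma (in prob_space) second_moment_sum_iid:
  fixes h :: "'b \<Rightarrow> real"
  assumes indep: "indep_vars (\<lambda>_. N) X I"
    and distr: "\<And>i. i \<in> I \<Longrightarrow> distr M N (X i) = N"
    and [measurable]: "h \<in> borel_measurable N"
    and bounded: "\<And>x. \<bar>h x\<bar> \<le> B"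
    and mean: "integral\<^sup>L N h = 0"
    and J: "finite J" "J \<subseteq> I"
  shows "expectation (\<lambda>w. (\<Sum>i\<in>J. h (X i w))\<^sup>2) = card J * integral\<^sup>L N (\<lambda>x. (h x)\<^sup>2)"
proof -
  have X[measurable]: "X i \<in> measurable M N" if "i \<in> I" for i
    using indep that by (auto simp: indep_vars_def)
  have hX[measurable]: "(\<lambda>w. h (X i w)) \<in> borel_measurable M" if "i \<in> J" for i
    using X[of i] that J by (auto intro: measurable_compose)
  have int_prod: "integrable M (\<lambda>w. h (X i w) * h (X j w))" if "i \<in> J" "j \<in> J" for i j
  proof (rule integrable_const_bound[of _ "B * B"])
    show "AE w in M. norm (h (X i w) * h (X j w)) \<le> B * B"
      using bounded by (auto intro!: AE_I2 mult_mono simp: abs_mult intro: order_trans[OF abs_ge_zero])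
  qed (use that in measurable)
  have diag: "expectation (\<lambda>w. h (X i w) * h (X i w)) = integral\<^sup>L N (\<lambda>x. (h x)\<^sup>2)"
    if "i \<in> J" for i
  proof -
    have "integral\<^sup>L (distr M N (X i)) (\<lambda>x. (h x)\<^sup>2) = expectation (\<lambda>w. (h (X i w))\<^sup>2)"
      using that J by (intro integral_distr) auto
    then show ?thesis using distr[of i] that J by (auto simp: power2_eq_square)
  qed
  have mean_X: "expectation (\<lambda>w. h (X i w)) = 0" if "i \<in> J" for i
  proof -
    have "integral\<^sup>L (distr M N (X i)) h = expectation (\<lambda>w. h (X i w))"
      using that J by (intro integral_distr) auto
    then show ?thesis using distr[of i] that J mean by auto
  qed
  have off: "expectation (\<lambda>w. h (X i w) * h (X j w)) = 0" if "i \<in> J" "j \<in> J" "i \<noteq> j" for i j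
  proof -
    have "indep_vars (\<lambda>_. borel) (\<lambda>i w. h (X i w)) I"
      by (rule indep_vars_compose2[OF indep]) auto
    then have "indep_vars (\<lambda>_. borel) (\<lambda>i w. h (X i w)) {i, j}"
      by (rule indep_vars_subset) (use that J in auto)
    moreover have "integrable M (\<lambda>w. h (X k w))" if "k \<in> {i, j}" for k
      using that \<open>i \<in> J\<close> \<open>j \<in> J\<close> bounded by (intro integrable_const_bound[of _ B]) auto
    ultimately have "expectation (\<lambda>w. \<Prod>k\<in>{i,j}. h (X k w)) = (\<Prod>k\<in>{i,j}. expectation (\<lambda>w. h (X k w)))"
      by (intro indep_vars_lebesgue_integral) auto
    then show ?thesis using that mean_X by simp
  qed
  have "expectation (\<lambda>w. (\<Sum>i\<in>J. h (X i w))\<^sup>2) = expectation (\<lambda>w. \<Sum>i\<in>J. \<Sum>j\<in>J. h (X i w) * h (X j w))"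
    by (simp add: power2_eq_square sum_product)
  also have "\<dots> = (\<Sum>i\<in>J. \<Sum>j\<in>J. expectation (\<lambda>w. h (X i w) * h (X j w)))"
    using int_prod by (subst Bochner_Integration.integral_sum; simp add: Bochner_Integration.integral_sum)+
  also have "\<dots> = (\<Sum>i\<in>J. \<Sum>j\<in>J. if i = j then integral\<^sup>L N (\<lambda>x. (h x)\<^sup>2) else 0)"
    by (intro sum.cong) (auto simp: diag off)
  also have "\<dots> = card J * integral\<^sup>L N (\<lambda>x. (h x)\<^sup>2)"
    using J by simp
  finally show ?thesis .
qed

text \<open>Summing \<open>sum_min_power2_le\<close> under the expectation bounds every partial sum
  by \<open>4 * expectation f\<close>. In the Borel-Cantelli argument this stands in for a finite
  second moment.\<close>

lemma (in prob_space) summable_truncated_second_moment: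
  fixes f :: "'a \<Rightarrow> real"
  assumes int: "integrable M f" and nonneg: "\<And>x. f x \<ge> 0"
  shows "summable (\<lambda>k. expectation (\<lambda>x. (min (f x) (2^k))\<^sup>2) / 2^k)"
proof (rule summableI_nonneg_bounded[where x = "4 * expectation f"])
  have [measurable]: "f \<in> borel_measurable M" using int by auto
  have i: "integrable M (\<lambda>x. (min (f x) (2^k))\<^sup>2 / 2^k)" for k
  proof (rule integrable_const_bound[of _ "(2^k)\<^sup>2 / 2^k"])
    have "(min (f x) (2^k))\<^sup>2 / 2^k \<le> (2^k)\<^sup>2 / 2^k" for x
      by (intro divide_right_mono power_mono) (auto simp: nonneg)
    then show "AE x in M. norm ((min (f x) (2^k))\<^sup>2 / 2^k) \<le> (2^k)\<^sup>2 / 2^k"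
      by auto
  qed simp
  fix K
  have "(\<Sum>k<K. expectation (\<lambda>x. (min (f x) (2^k))\<^sup>2) / 2^k)
      = expectation (\<lambda>x. \<Sum>k<K. (min (f x) (2^k))\<^sup>2 / 2^k)"
    using i by (subst Bochner_Integration.integral_sum) auto
  also have "\<dots> \<le> expectation (\<lambda>x. 4 * f x)"
    using i int nonneg by (intro integral_mono) (auto intro!: sum_min_power2_le)
  finally show "(\<Sum>k<K. expectation (\<lambda>x. (min (f x) (2^k))\<^sup>2) / 2^k) \<le> 4 * expectation f" by simp
qed (auto intro!: Bochner_Integration.integral_nonneg divide_nonneg_nonneg)

text \<open>
  The factor 2 comes from comparing \<open>n\<close> with the next power of two; it spares the finer
  subsequences of Etemadi's argument.
\<close>

lemma (in prob_space) eventually_sum_iid_le: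
  fixes f :: "'b \<Rightarrow> real" and C :: real
  assumes N: "prob_space N"
    and indep: "indep_vars (\<lambda>_. N) X {1..}"
    and distr: "\<And>i. i \<ge> 1 \<Longrightarrow> distr M N (X i) = N"
    and int: "integrable N f" and nonneg: "\<And>x. f x \<ge> 0"
    and C: "2 * integral\<^sup>L N f < C"
  shows "AE w in M. \<forall>\<^sub>F n in sequentially. (\<Sum>i\<in>{1..n}. f (X i w)) \<le> n * C"
proof -
  interpret N: prob_space N by (rule N)
  define \<mu> where "\<mu> = integral\<^sup>L N f"
  \<comment> \<open>Chosen so that \<open>2 * (\<mu> + e) = C\<close>: along powers of two the mean
    stays below \<open>\<mu> + e\<close>, and the passage to all \<open>n\<close> doubles
    this.\<close>
  define e where "e = C / 2 - \<mu>"
  have e: "e > 0" using C by (simp add: e_def \<mu>_def)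
  have [measurable]: "f \<in> borel_measurable N" using int by auto
  have X[measurable]: "X i \<in> measurable M N" if "i \<in> {1..n}" for i n
    using indep that by (auto simp: indep_vars_def)
  define T where "T k x = min (f x) (2^k)" for k x
  define v where "v k = integral\<^sup>L N (\<lambda>x. (T k x)\<^sup>2)" for k
  define A where "A k = {w\<in>space M. \<not> (\<Sum>i\<in>{1..2^k}. f (X i w)) \<le> 2^k * (\<mu> + e)}" for k
  have T_meas[measurable]: "T k \<in> borel_measurable N" for k
    unfolding T_def by measurable
  have T: "0 \<le> T k x" "T k x \<le> 2^k" "T k x \<le> f x" for k x
    by (auto simp: T_def nonneg)
  have T_int: "integrable N (T k)" for k
    using T by (intro N.integrable_const_bound[of _ "2^k"]) auto
  have T2_int: "integrable N (\<lambda>x. (T k x)\<^sup>2)" for k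
    using T by (intro N.integrable_const_bound[of _ "(2^k)\<^sup>2"]) (auto intro!: power_mono)
  have A_meas[measurable]: "A k \<in> sets M" for k
    unfolding A_def by measurable
  \<comment> \<open>\<open>A k\<close> requires a value reaching the truncation level
    (\<open>E1\<close>) or a deviation of the truncated sum (\<open>E2\<close>). Chebyshev's
    inequality bounds both contributions by multiples of \<open>v k / 2^k\<close>.\<close>
  have prob_A: "prob (A k) \<le> (1 + 1 / e\<^sup>2) * (v k / 2^k)" for k
  proof -
    define m where "m = integral\<^sup>L N (T k)"
    define D where "D w = (\<Sum>i\<in>{1..2^k}. T k (X i w) - m)" for w
    define E1 where "E1 i = {w\<in>space M. \<bar>f (X i w)\<bar> \<ge> 2^k}" for i
    define E2 where "E2 = {w\<in>space M. \<bar>D w\<bar> \<ge> 2^k * e}"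
    have D_meas[measurable]: "D \<in> borel_measurable M"
      unfolding D_def
      by (intro borel_measurable_sum borel_measurable_diff borel_measurable_const
          measurable_compose[OF X T_meas])
    have E1_meas[measurable]: "E1 i \<in> sets M" if "i \<in> {1..2^k}" for i
      using X[OF that] unfolding E1_def by measurable
    have E2_meas[measurable]: "E2 \<in> sets M"
      unfolding E2_def by measurable
    have "0 \<le> m" using T by (auto simp: m_def intro: Bochner_Integration.integral_nonneg)
    have "m \<le> \<mu>"
      unfolding m_def \<mu>_def using T T_int int by (intro integral_mono) auto
    have sub: "A k \<subseteq> (\<Union>i\<in>{1..2^k}. E1 i) \<union> E2"
    proof
      fix w assume w: "w \<in> A k"
      show "w \<in> (\<Union>i\<in>{1..2^k}. E1 i) \<union> E2"
      proof (cases "\<exists>i\<in>{1..2^k}. w \<in> E1 i")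
        case False
        then have "f (X i w) = T k (X i w)" if "i \<in> {1..2^k}" for i
          using that w by (force simp: E1_def A_def T_def min_def)
        then have "D w = (\<Sum>i\<in>{1..2^k}. f (X i w)) - 2^k * m"
          by (simp add: D_def sum_subtractf)
        moreover have "2^k * m \<le> 2^k * \<mu>" using \<open>m \<le> \<mu>\<close> by simp
        moreover have "(\<Sum>i\<in>{1..2^k}. f (X i w)) > 2^k * \<mu> + 2^k * e"
          using w by (simp add: A_def distrib_left)
        ultimately have "D w \<ge> 2^k * e" by linarith
        then show ?thesis using w by (auto simp: E2_def A_def)
      qed auto
    qed
    have E1: "prob (E1 i) \<le> v k / (2^k)\<^sup>2" if "i \<in> {1..2^k}" for i
    proof -
      \<comment> \<open>\<open>f\<close> reaches \<open>2^k\<close> exactly when \<open>T k\<close>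
        does, so Chebyshev's inequality applies to the truncated variable, although \<open>f\<close>
        may lack a second moment.\<close>
      have "prob (E1 i) = measure (distr M N (X i)) {x\<in>space N. \<bar>T k x\<bar> \<ge> 2^k}"
        using that X[OF that] measurable_space[OF X[OF that]]
        by (subst measure_distr) (auto simp: E1_def T_def nonneg intro!: arg_cong[where f=prob])
      also have "\<dots> = measure N {x\<in>space N. \<bar>T k x\<bar> \<ge> 2^k}"
        using distr that by simp
      also have "\<dots> \<le> v k / (2^k)\<^sup>2"
        unfolding v_def by (rule N.second_moment_method) (auto simp: T2_int)
      finally show ?thesis .
    qed
    have E2: "prob E2 \<le> (2^k * v k) / (2^k * e)\<^sup>2"
    proof -
      have "expectation (\<lambda>w. (D w)\<^sup>2) = card {1..(2::nat)^k} * integral\<^sup>L N (\<lambda>x. (T k x - m)\<^sup>2)"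
        unfolding D_def
      proof (rule second_moment_sum_iid[where N = N and I = "{1..}" and B = "2^k + m"])
        show "integral\<^sup>L N (\<lambda>x. T k x - m) = 0"
          using T_int by (simp add: m_def N.prob_space)
        show "\<bar>T k x - m\<bar> \<le> 2^k + m" for x
          using T(1,2)[of k x] \<open>0 \<le> m\<close> by (simp add: abs_le_iff)
      qed (use indep distr in auto)
      also have "integral\<^sup>L N (\<lambda>x. (T k x - m)\<^sup>2) \<le> v k"
        using N.variance_eq[OF T_int T2_int] by (simp add: m_def v_def)
      finally have le: "expectation (\<lambda>w. (D w)\<^sup>2) \<le> 2^k * v k" by simp
      have "integrable M (\<lambda>w. (D w)\<^sup>2)"
      proof (rule integrable_const_bound[of _ "(2^k * (2^k + m))\<^sup>2"])
        have "\<bar>D w\<bar> \<le> 2^k * (2^k + m)" for w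
        proof -
          have "\<bar>D w\<bar> \<le> (\<Sum>i\<in>{1..2^k}. \<bar>T k (X i w) - m\<bar>)"
            unfolding D_def by (rule sum_abs)
          also have "\<dots> \<le> (\<Sum>i\<in>{1..(2::nat)^k}. 2^k + m)"
          proof (rule sum_mono)
            fix i show "\<bar>T k (X i w) - m\<bar> \<le> 2^k + m"
              using T(1,2)[of k "X i w"] \<open>0 \<le> m\<close> by (simp add: abs_le_iff)
          qed
          finally show ?thesis by simp
        qed
        then have "(D w)\<^sup>2 \<le> (2^k * (2^k + m))\<^sup>2" for w
          by (metis abs_ge_zero power2_abs power_mono)
        then show "AE w in M. norm ((D w)\<^sup>2) \<le> (2^k * (2^k + m))\<^sup>2" by auto
      qed simp
      then have "prob E2 \<le> expectation (\<lambda>w. (D w)\<^sup>2) / (2^k * e)\<^sup>2"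
        unfolding E2_def using e by (intro second_moment_method) auto
      also have "\<dots> \<le> (2^k * v k) / (2^k * e)\<^sup>2"
        using le by (intro divide_right_mono) auto
      finally show ?thesis .
    qed
    have "prob (A k) \<le> prob ((\<Union>i\<in>{1..2^k}. E1 i) \<union> E2)"
      by (intro finite_measure_mono sub) auto
    also have "\<dots> \<le> prob (\<Union>i\<in>{1..2^k}. E1 i) + prob E2"
      by (intro measure_Un_le) auto
    also have "prob (\<Union>i\<in>{1..2^k}. E1 i) \<le> (\<Sum>i\<in>{1..2^k}. prob (E1 i))"
      by (intro finite_measure_subadditive_finite) auto
    also have "\<dots> \<le> (\<Sum>i\<in>{1..(2::nat)^k}. v k / (2^k)\<^sup>2)"
      by (intro sum_mono E1)
    finally have "prob (A k) \<le> 2^k * (v k / (2^k)\<^sup>2) + (2^k * v k) / (2^k * e)\<^sup>2"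
      using E2 by simp
    also have "\<dots> = (1 + 1 / e\<^sup>2) * (v k / 2^k)"
      using e by (simp add: field_simps power2_eq_square)
    finally show ?thesis .
  qed
  have "summable (\<lambda>k. (1 + 1 / e\<^sup>2) * (v k / 2^k))"
    unfolding v_def T_def by (intro summable_mult N.summable_truncated_second_moment int nonneg)
  then have "summable (\<lambda>k. prob (A k))"
    by (rule summable_comparison_test_ev[rotated]) (use prob_A in auto)
  then have "AE w in M. \<forall>\<^sub>F k in sequentially. w \<in> space M - A k"
    by (intro borel_cantelli_AE1) (auto simp: emeasure_eq_measure)
  then show ?thesis
  proof (rule AE_mp, intro AE_I2 impI)
    fix w assume w: "w \<in> space M" and "\<forall>\<^sub>F k in sequentially. w \<in> space M - A k"
    then obtain K where K: "\<And>k. k \<ge> K \<Longrightarrow> (\<Sum>i\<in>{1..2^k}. f (X i w)) \<le> 2^k * (\<mu> + e)"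
      by (auto simp: eventually_sequentially A_def)
    have "(\<Sum>i\<in>{1..n}. f (X i w)) \<le> n * C" if n: "n \<ge> 2^K" for n :: nat
    proof -
      have "n > 0" using n by (metis not_gr0 power_not_zero rel_simps(28) zero_neq_numeral le_zero_eq)
      then obtain k where k: "2^k \<le> n" "n < 2^(k+1)"
        using ex_power_ivl1[of 2 n] by auto
      have "(2::nat)^K < 2^(k+1)" using n k by linarith
      then have "K \<le> k + 1" by (simp add: power_strict_increasing_iff del: power_Suc)
      have "0 \<le> \<mu>" unfolding \<mu>_def by (intro Bochner_Integration.integral_nonneg nonneg)
      \<comment> \<open>By nonnegativity the sums increase with \<open>n\<close>, so the next power
        of two gives the bound \<open>2^(k+1) * (\<mu> + e) = 2^k * C\<close>.\<close>
      have "(\<Sum>i\<in>{1..n}. f (X i w)) \<le> (\<Sum>i\<in>{1..2^(k+1)}. f (X i w))"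
        using k nonneg by (intro sum_mono2) auto
      also have "\<dots> \<le> 2^(k+1) * (\<mu> + e)" using K \<open>K \<le> k + 1\<close> by blast
      also have "\<dots> = real (2^k) * C" by (simp add: e_def)
      also have "\<dots> \<le> n * C"
        using k e \<open>0 \<le> \<mu>\<close> by (intro mult_right_mono) (auto simp: e_def simp del: of_nat_power)
      finally show ?thesis .
    qed
    then show "\<forall>\<^sub>F n in sequentially. (\<Sum>i\<in>{1..n}. f (X i w)) \<le> n * C"
      by (auto simp: eventually_sequentially)
  qed
qed

section \<open>Exponential families\<close>

locale exponential_family =
  fixes XX :: "(real^'d) set" and lam :: "(real^'d) measure" and s :: "real^'d \<Rightarrow> real^'k"
  assumes well_behaved: "well_behaved_expfam XX lam s"
begin

abbreviation Th :: "(real^'k) set" where "Th \<equiv> Theta lam s"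
abbreviation \<kappa> :: "real^'k \<Rightarrow> real" where "\<kappa> \<equiv> kappa lam s"
abbreviation Mom :: "(real^'k) set" where "Mom \<equiv> moment_space lam s"

definition mean :: "real^'k \<Rightarrow> real^'k" where
  "mean \<theta> = (\<integral>x. s x \<partial>expfam_measure lam s \<theta>)"

lemma Mom_eq: "Mom = mean ` Th"
  by (simp add: moment_space_def mean_def)

lemma s_measurable[measurable]: "s \<in> borel_measurable lam"
  and open_Th: "open Th"
  and Th_nonempty: "Th \<noteq> {}"
  and sets_lam: "sets lam = sets (restrict_space borel XX)"
  and identifiable: "\<lbrakk>\<theta> \<in> Th; \<theta>' \<in> Th; \<theta> \<noteq> \<theta>'\<rbrakk> \<Longrightarrow> expfam_measure lam s \<theta> \<noteq> expfam_measure lam s \<theta>'"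
  using well_behaved by (auto simp: well_behaved_expfam_def)

lemma space_lam: "space lam = XX"
  using sets_eq_imp_space_eq[OF sets_lam] by (simp add: space_restrict_space)

lemma XX_nonempty: "XX \<noteq> {}"
  using well_behaved by (auto simp: well_behaved_expfam_def)

section \<open>The log-partition function\<close>

lemma Th_iff_integrable: "\<theta> \<in> Th \<longleftrightarrow> integrable lam (\<lambda>x. exp (\<theta> \<bullet> s x))"
  by (auto simp: Theta_def kappa_ext_def log_ext_def integrable_iff_bounded less_top)

lemma laplace_pos:
  assumes "\<theta> \<in> Th" shows "(\<integral>x. exp (\<theta> \<bullet> s x) \<partial>lam) > 0"
proof -
  have "(\<integral>x. exp (\<theta> \<bullet> s x) \<partial>lam) \<noteq> 0"
  proof
    assume "(\<integral>x. exp (\<theta> \<bullet> s x) \<partial>lam) = 0"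
    then have "AE x in lam. exp (\<theta> \<bullet> s x) = 0"
      using assms Th_iff_integrable by (subst (asm) integral_nonneg_eq_0_iff_AE) auto
    then have "AE x in lam. False" by simp
    then have "emeasure lam (space lam) = 0" by (simp add: AE_iff_measurable[OF _ refl])
    then show False using well_behaved by (simp add: well_behaved_expfam_def space_lam)
  qed
  then show ?thesis by (simp add: less_le)
qed

lemma kappa_eq_ln:
  assumes "\<theta> \<in> Th" shows "\<kappa> \<theta> = ln (\<integral>x. exp (\<theta> \<bullet> s x) \<partial>lam)"
proof -
  have "(\<integral>\<^sup>+x. ennreal (exp (\<theta> \<bullet> s x)) \<partial>lam) = ennreal (\<integral>x. exp (\<theta> \<bullet> s x) \<partial>lam)"
    using assms Th_iff_integrable by (intro nn_integral_eq_integral) auto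
  then show ?thesis
    using laplace_pos[OF assms] by (simp add: kappa_def kappa_ext_def log_ext_def)
qed

lemma exp_kappa:
  "\<theta> \<in> Th \<Longrightarrow> exp (\<kappa> \<theta>) = (\<integral>x. exp (\<theta> \<bullet> s x) \<partial>lam)"
  by (simp add: kappa_eq_ln laplace_pos)

lemma exp_convex_comb:
  fixes a b t :: real
  assumes "0 \<le> t" "t \<le> 1"
  shows "exp ((1 - t) * a + t * b) \<le> (1 - t) * exp a + t * exp b"
  using convex_onD[OF exp_convex, of t a b] assms by simp

text \<open>Convexity of \<open>exp\<close> passes to the integral. A convex function on an open set
  is continuous, which yields continuity of \<open>\<kappa>\<close> without differentiation under
  the integral.\<close>

lemma laplace_convex: "convex_on Th (\<lambda>\<theta>. \<integral>x. exp (\<theta> \<bullet> s x) \<partial>lam)"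
proof -
  have le: "exp (((1 - t) *\<^sub>R a + t *\<^sub>R b) \<bullet> s x) \<le> (1 - t) * exp (a \<bullet> s x) + t * exp (b \<bullet> s x)"
    if "0 < t" "t < 1" for t a b x
    using exp_convex_comb[of t "a \<bullet> s x" "b \<bullet> s x"] that by (simp add: inner_add_left)
  have in_Th: "(1 - t) *\<^sub>R a + t *\<^sub>R b \<in> Th" if "0 < t" "t < 1" "a \<in> Th" "b \<in> Th" for t a b
    unfolding Th_iff_integrable
  proof (rule Bochner_Integration.integrable_bound)
    show "integrable lam (\<lambda>x. (1 - t) * exp (a \<bullet> s x) + t * exp (b \<bullet> s x))"
      using that by (auto simp: Th_iff_integrable)
    show "AE x in lam. norm (exp (((1 - t) *\<^sub>R a + t *\<^sub>R b) \<bullet> s x))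
        \<le> norm ((1 - t) * exp (a \<bullet> s x) + t * exp (b \<bullet> s x))"
      using le[OF that(1,2)] by (auto intro!: AE_I2 intro: order_trans[OF _ abs_ge_self])
  qed simp
  show ?thesis
  proof (rule convex_onI)
    show "convex Th"
      unfolding convex_alt using in_Th by (metis add.right_neutral diff_add_cancel diff_zero
          le_less pth_4(1) scaleR_one add_0 diff_self)
    fix t :: real and a b :: "real^'k"
    assume t: "0 < t" "t < 1" and ab: "a \<in> Th" "b \<in> Th"
    have "(\<integral>x. exp (((1 - t) *\<^sub>R a + t *\<^sub>R b) \<bullet> s x) \<partial>lam)
        \<le> (\<integral>x. (1 - t) * exp (a \<bullet> s x) + t * exp (b \<bullet> s x) \<partial>lam)"
      using le[OF t] in_Th[OF t ab] ab by (intro integral_mono) (auto simp: Th_iff_integrable)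
    also have "\<dots> = (1 - t) * (\<integral>x. exp (a \<bullet> s x) \<partial>lam) + t * (\<integral>x. exp (b \<bullet> s x) \<partial>lam)"
      using ab by (simp add: Th_iff_integrable)
    finally show "(\<integral>x. exp (((1 - t) *\<^sub>R a + t *\<^sub>R b) \<bullet> s x) \<partial>lam)
        \<le> (1 - t) * (\<integral>x. exp (a \<bullet> s x) \<partial>lam) + t * (\<integral>x. exp (b \<bullet> s x) \<partial>lam)" .
  qed
qed

lemma kappa_continuous: "continuous_on Th \<kappa>"
proof -
  have "continuous_on Th (\<lambda>\<theta>. ln (\<integral>x. exp (\<theta> \<bullet> s x) \<partial>lam))"
    using laplace_pos
    by (intro continuous_on_ln convex_on_continuous[OF open_Th laplace_convex]) force
  then show ?thesis by (simp add: kappa_eq_ln cong: continuous_on_cong)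
qed

section \<open>Densities, means and tangent planes\<close>

abbreviation dens :: "real^'k \<Rightarrow> real^'d \<Rightarrow> real" where "dens \<equiv> expfam_density lam s"

lemma dens_measurable[measurable]: "dens \<theta> \<in> borel_measurable lam"
  unfolding expfam_density_def[abs_def] by measurable

lemma dens_pos: "dens \<theta> x > 0"
  by (simp add: expfam_density_def)

lemma dens_eq: "dens \<theta> x = exp (\<theta> \<bullet> s x) / exp (\<kappa> \<theta>)"
  by (simp add: expfam_density_def exp_diff)

lemma integrable_dens: "\<theta> \<in> Th \<Longrightarrow> integrable lam (dens \<theta>)"
  by (simp add: dens_eq[abs_def] Th_iff_integrable)

lemma integral_dens: "\<theta> \<in> Th \<Longrightarrow> (\<integral>x. dens \<theta> x \<partial>lam) = 1"
  using laplace_pos[of \<theta>] by (simp add: dens_eq[abs_def] exp_kappa)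

text \<open>As \<open>Th\<close> is open, \<open>\<theta> + d *\<^sub>R v\<close> and
  \<open>\<theta> - d *\<^sub>R v\<close> lie in it for small \<open>d\<close>, and
  \<open>d * \<bar>z\<bar> \<le> exp (d * z) + exp (- (d * z))\<close> supplies an integrable
  bound.\<close>

lemma integrable_dens_inner:
  assumes "\<theta> \<in> Th" shows "integrable lam (\<lambda>x. dens \<theta> x * (s x \<bullet> v))"
proof -
  obtain e where e: "e > 0" "cball \<theta> e \<subseteq> Th"
    using open_Th assms open_contains_cball by blast
  \<comment> \<open>The summand 1 covers \<open>v = 0\<close>.\<close>
  define d where "d = e / (1 + norm v)"
  have "1 + norm v > 0" by (simp add: add_pos_nonneg)
  then have d: "d > 0" "d * norm v \<le> e"
    using e by (auto simp: d_def pos_divide_le_eq algebra_simps)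
  have Th: "\<theta> + d *\<^sub>R v \<in> Th" "\<theta> - d *\<^sub>R v \<in> Th"
    using e(2) d by (auto simp: dist_norm)
  have bound: "exp (\<theta> \<bullet> s x) * \<bar>s x \<bullet> v\<bar>
      \<le> (exp ((\<theta> + d *\<^sub>R v) \<bullet> s x) + exp ((\<theta> - d *\<^sub>R v) \<bullet> s x)) / d" for x
  proof -
    have "d * \<bar>s x \<bullet> v\<bar> \<le> exp (d * (s x \<bullet> v)) + exp (- (d * (s x \<bullet> v)))"
      using exp_ge_add_one_self[of "d * (s x \<bullet> v)"] exp_ge_add_one_self[of "- (d * (s x \<bullet> v))"]
        exp_gt_zero[of "d * (s x \<bullet> v)"] exp_gt_zero[of "- (d * (s x \<bullet> v))"] d(1)
      by (cases "s x \<bullet> v \<ge> 0"; simp; linarith)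
    then have "exp (\<theta> \<bullet> s x) * (d * \<bar>s x \<bullet> v\<bar>)
        \<le> exp (\<theta> \<bullet> s x) * (exp (d * (s x \<bullet> v)) + exp (- (d * (s x \<bullet> v))))"
      by (intro mult_left_mono) auto
    moreover have "(\<theta> + d *\<^sub>R v) \<bullet> s x = \<theta> \<bullet> s x + d * (s x \<bullet> v)"
      "(\<theta> - d *\<^sub>R v) \<bullet> s x = \<theta> \<bullet> s x + - (d * (s x \<bullet> v))"
      by (simp_all add: inner_add_left inner_diff_left inner_commute[of v])
    ultimately show ?thesis
      using d by (simp only: pos_le_divide_eq exp_add distrib_left) (simp add: mult_ac)
  qed
  have "integrable lam (\<lambda>x. exp (\<theta> \<bullet> s x) * (s x \<bullet> v))"
  proof (rule Bochner_Integration.integrable_bound)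
    show "integrable lam (\<lambda>x. (exp ((\<theta> + d *\<^sub>R v) \<bullet> s x) + exp ((\<theta> - d *\<^sub>R v) \<bullet> s x)) / d)"
      using Th by (simp add: Th_iff_integrable)
    show "AE x in lam. norm (exp (\<theta> \<bullet> s x) * (s x \<bullet> v))
        \<le> norm ((exp ((\<theta> + d *\<^sub>R v) \<bullet> s x) + exp ((\<theta> - d *\<^sub>R v) \<bullet> s x)) / d)"
      using bound d by (auto intro!: AE_I2 simp: abs_mult)
  qed simp
  then show ?thesis by (simp add: dens_eq)
qed

lemma mean_inner:
  assumes "\<theta> \<in> Th" shows "mean \<theta> \<bullet> v = (\<integral>x. dens \<theta> x * (s x \<bullet> v) \<partial>lam)"
proof -
  \<comment> \<open>A Bochner integral of a non-integrable function is 0 by convention, so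
    integrability of the vector-valued integrand is first assembled from its coordinates.\<close>
  have "integrable lam (\<lambda>x. \<Sum>b\<in>Basis. (dens \<theta> x * (s x \<bullet> b)) *\<^sub>R b)"
    using integrable_dens_inner[OF assms] by (intro Bochner_Integration.integrable_sum integrable_scaleR_left)
  also have "(\<lambda>x. \<Sum>b\<in>Basis. (dens \<theta> x * (s x \<bullet> b)) *\<^sub>R b) = (\<lambda>x. dens \<theta> x *\<^sub>R s x)"
    by (simp add: euclidean_representation scaleR_sum_right[symmetric] flip: scaleR_scaleR)
  finally have int: "integrable lam (\<lambda>x. dens \<theta> x *\<^sub>R s x)" .
  have "mean \<theta> = (\<integral>x. dens \<theta> x *\<^sub>R s x \<partial>lam)"
    unfolding mean_def expfam_measure_def using dens_pos
    by (intro integral_density) (auto intro!: AE_I2 less_imp_le)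
  then show ?thesis
    using integral_inner_left[of v lam "\<lambda>x. dens \<theta> x *\<^sub>R s x"] int by simp
qed

text \<open>Jensen's inequality for \<open>exp\<close> under the law at \<open>\<theta>0\<close>:
  integrate the tangent bound \<open>exp z \<ge> exp c * (1 + (z - c))\<close>. The mean plays the
  part of the gradient of \<open>\<kappa>\<close>.\<close>

lemma kappa_tangent:
  assumes \<theta>: "\<theta> \<in> Th" and \<theta>0: "\<theta>0 \<in> Th"
  shows "\<kappa> \<theta> \<ge> \<kappa> \<theta>0 + mean \<theta>0 \<bullet> (\<theta> - \<theta>0)"
proof -
  define c where "c = mean \<theta>0 \<bullet> (\<theta> - \<theta>0)"
  have "exp c = (\<integral>x. exp c * (dens \<theta>0 x + (dens \<theta>0 x * (s x \<bullet> (\<theta> - \<theta>0)) - c * dens \<theta>0 x)) \<partial>lam)"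
    using integrable_dens[OF \<theta>0] integrable_dens_inner[OF \<theta>0, of "\<theta> - \<theta>0"]
      integral_dens[OF \<theta>0] mean_inner[OF \<theta>0, of "\<theta> - \<theta>0"]
    by (simp add: c_def)
  also have "\<dots> \<le> (\<integral>x. exp (\<theta> \<bullet> s x) / exp (\<kappa> \<theta>0) \<partial>lam)"
  proof (rule integral_mono)
    fix x
    define z where "z = s x \<bullet> (\<theta> - \<theta>0)"
    have "exp c * (1 + (z - c)) \<le> exp c * exp (z - c)"
      by (intro mult_left_mono exp_ge_add_one_self) auto
    then have "dens \<theta>0 x * (exp c * (1 + (z - c))) \<le> dens \<theta>0 x * exp z"
      using dens_pos[of \<theta>0 x] by (intro mult_left_mono) (auto simp: exp_diff)
    also have "\<dots> = exp (\<theta> \<bullet> s x) / exp (\<kappa> \<theta>0)"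
      by (simp add: dens_eq z_def inner_commute[of "s x"] inner_diff_left exp_diff)
    finally show "exp c * (dens \<theta>0 x + (dens \<theta>0 x * (s x \<bullet> (\<theta> - \<theta>0)) - c * dens \<theta>0 x))
        \<le> exp (\<theta> \<bullet> s x) / exp (\<kappa> \<theta>0)"
      by (simp add: z_def algebra_simps)
  qed (use \<theta> integrable_dens[OF \<theta>0] integrable_dens_inner[OF \<theta>0, of "\<theta> - \<theta>0"]
      in \<open>auto simp: Th_iff_integrable\<close>)
  also have "\<dots> = exp (\<kappa> \<theta> - \<kappa> \<theta>0)"
    using \<theta> by (simp add: exp_kappa[symmetric] exp_diff)
  finally show ?thesis by (simp add: c_def)
qed

text \<open>The inner product is the integral of \<open>g\<close>, whose two factors always have the
  same sign. If it vanished, the densities would agree almost everywhere, against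
  identifiability.\<close>

lemma mean_strict_mono:
  assumes \<theta>: "\<theta> \<in> Th" and \<theta>0: "\<theta>0 \<in> Th" and "\<theta> \<noteq> \<theta>0"
  shows "(mean \<theta> - mean \<theta>0) \<bullet> (\<theta> - \<theta>0) > 0"
proof -
  \<comment> \<open>The value of \<open>s x \<bullet> (\<theta> - \<theta>0)\<close> at which both
    densities coincide. Subtracting it leaves the integral unchanged, since both densities have
    total mass 1.\<close>
  define c where "c = \<kappa> \<theta> - \<kappa> \<theta>0"
  define g where "g x = (s x \<bullet> (\<theta> - \<theta>0) - c) * (dens \<theta> x - dens \<theta>0 x)" for x
  note ints = integrable_dens[OF \<theta>] integrable_dens[OF \<theta>0]
    integrable_dens_inner[OF \<theta>, of "\<theta> - \<theta>0"] integrable_dens_inner[OF \<theta>0, of "\<theta> - \<theta>0"]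
  have g_eq: "g = (\<lambda>x. (dens \<theta> x * (s x \<bullet> (\<theta> - \<theta>0)) - dens \<theta>0 x * (s x \<bullet> (\<theta> - \<theta>0)))
      - (c * dens \<theta> x - c * dens \<theta>0 x))"
    by (auto simp: g_def algebra_simps)
  have g_int: "integrable lam g"
    unfolding g_eq using ints by simp
  have "integral\<^sup>L lam g = (mean \<theta> - mean \<theta>0) \<bullet> (\<theta> - \<theta>0)"
    unfolding g_eq using ints by (simp add: integral_dens \<theta> \<theta>0 inner_diff_left mean_inner)
  moreover have dens_less: "dens \<theta>0 x < dens \<theta> x \<longleftrightarrow> 0 < s x \<bullet> (\<theta> - \<theta>0) - c"
    and dens_gr: "dens \<theta> x < dens \<theta>0 x \<longleftrightarrow> s x \<bullet> (\<theta> - \<theta>0) - c < 0" for x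
    by (auto simp: expfam_density_def c_def inner_diff_right inner_commute)
  have g_nonneg: "g x \<ge> 0" and g_0: "g x = 0 \<longleftrightarrow> dens \<theta> x = dens \<theta>0 x" for x
    unfolding g_def using dens_less[of x] dens_gr[of x]
    by (cases "dens \<theta>0 x" "dens \<theta> x" rule: linorder_cases; force intro: mult_nonneg_nonneg mult_nonpos_nonpos)+
  have "integral\<^sup>L lam g \<noteq> 0"
  proof
    assume "integral\<^sup>L lam g = 0"
    then have "AE x in lam. dens \<theta> x = dens \<theta>0 x"
      using g_int g_nonneg by (subst (asm) integral_nonneg_eq_0_iff_AE) (auto simp: g_0)
    then have "expfam_measure lam s \<theta> = expfam_measure lam s \<theta>0"
      unfolding expfam_measure_def by (intro density_cong) auto
    then show False using identifiable assms by blast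
  qed
  moreover have "integral\<^sup>L lam g \<ge> 0"
    using g_nonneg by (intro Bochner_Integration.integral_nonneg)
  ultimately show ?thesis by simp
qed

text \<open>A small move of the parameter in direction \<open>u\<close>, possible since
  \<open>Th\<close> is open, strictly raises the mean in that direction.\<close>

lemma Mom_inner_no_max:
  assumes m: "m \<in> Mom" and "u \<noteq> 0"
  obtains m' where "m' \<in> Mom" "m' \<bullet> u > m \<bullet> u"
proof -
  obtain \<theta> where \<theta>: "\<theta> \<in> Th" "m = mean \<theta>" using m by (auto simp: Mom_eq)
  obtain e where e: "e > 0" "cball \<theta> e \<subseteq> Th"
    using open_Th \<theta> open_contains_cball by blast
  define d where "d = e / norm u"
  have d: "d > 0" "\<theta> + d *\<^sub>R u \<in> Th"
    using e \<open>u \<noteq> 0\<close> by (auto simp: d_def dist_norm)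
  then have "d * ((mean (\<theta> + d *\<^sub>R u) - m) \<bullet> u) > 0"
    using mean_strict_mono[of "\<theta> + d *\<^sub>R u" \<theta>] \<theta> \<open>u \<noteq> 0\<close> by simp
  then have "mean (\<theta> + d *\<^sub>R u) \<bullet> u > m \<bullet> u"
    using d by (simp add: zero_less_mult_iff inner_diff_left)
  then show ?thesis using d by (intro that) (auto simp: Mom_eq)
qed

end

section \<open>Averages over large subsets of a sample\<close>

locale exponential_family_sample = exponential_family XX lam s + P: prob_space P
  for XX :: "(real^'d) set" and lam :: "(real^'d) measure" and s :: "real^'d \<Rightarrow> real^'k"
    and P :: "(real^'d) measure" +
  assumes P_sets: "sets P = sets (restrict_space borel XX)"
    and s_integrable: "integrable P (\<lambda>x. norm (s x))"
    and s_in_closure: "measure P {x \<in> space P. s x \<in> closure Mom} = 1"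
    and s_off_hyperplane: "\<And>L. hyperplane L \<Longrightarrow> L \<inter> Mom = {} \<Longrightarrow>
                  measure P {x \<in> space P. s x \<in> L} = 0"
begin

lemma s_measurable_P[measurable]: "s \<in> borel_measurable P"
  using s_measurable measurable_cong_sets[of P lam borel borel] P_sets sets_lam by auto

lemma space_P: "space P = XX"
  using sets_eq_imp_space_eq[OF P_sets] by (simp add: space_restrict_space)

text \<open>The closure condition gives the weak inequality. The hyperplane at the level of the
  supremum misses \<open>Mom\<close>, because the supremum is not attained, and so has probability
  0.\<close>

lemma AE_inner_less:
  assumes "u \<noteq> 0" and bdd: "bdd_above ((\<lambda>m. m \<bullet> u) ` Mom)"
  shows "AE x in P. s x \<bullet> u < (SUP m\<in>Mom. m \<bullet> u)"
proof -
  define h where "h = (SUP m\<in>Mom. m \<bullet> u)"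
  have le: "m \<bullet> u \<le> h" if "m \<in> Mom" for m
    unfolding h_def using that bdd by (rule cSUP_upper)
  have "Mom \<subseteq> {y. u \<bullet> y \<le> h}" using le by (auto simp: inner_commute)
  then have sub: "closure Mom \<subseteq> {y. u \<bullet> y \<le> h}"
    by (rule closure_minimal) (rule closed_halfspace_le)
  have "AE x in P. x \<in> {x \<in> space P. s x \<in> closure Mom}"
    using s_in_closure by (intro P.AE_prob_1) auto
  moreover have "AE x in P. x \<notin> {x \<in> space P. s x \<in> {y. y \<bullet> u = h}}"
  proof -
    have "m \<bullet> u \<noteq> h" if "m \<in> Mom" for m
      using Mom_inner_no_max[OF that \<open>u \<noteq> 0\<close>] le by (metis not_le)
    then have "{y. y \<bullet> u = h} \<inter> Mom = {}" by auto
    moreover have "hyperplane {y. y \<bullet> u = h}"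
      using \<open>u \<noteq> 0\<close> by (auto simp: hyperplane_def)
    ultimately have "measure P {x \<in> space P. s x \<in> {y. y \<bullet> u = h}} = 0"
      by (intro s_off_hyperplane)
    moreover have "{x \<in> space P. s x \<in> {y. y \<bullet> u = h}} \<in> sets P" by simp
    ultimately show ?thesis
      by (intro AE_not_in) (auto simp: null_sets_def P.emeasure_eq_measure)
  qed
  ultimately show ?thesis
    using AE_space
  proof eventually_elim
    case (elim x)
    then show ?case using sub by (auto simp: h_def inner_commute order_le_less)
  qed
qed

text \<open>
  Applied to the deficit by the law of large numbers, this shows that the moment \<open>m\<close> beats, in
  direction \<open>u\<close>, the average of \<open>s\<close> over every subset of positive proportion.
\<close>

lemma exists_moment_small_deficit:
  assumes "u \<noteq> 0" and \<beta>: "\<beta> > 0"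
  shows "\<exists>m\<in>Mom. \<exists>d>0. (\<integral>x. max 0 (d - (m - s x) \<bullet> u) \<partial>P) < \<beta> * d"
proof (cases "bdd_above ((\<lambda>m. m \<bullet> u) ` Mom)")
  case True
  define h where "h = (SUP m\<in>Mom. m \<bullet> u)"
  \<comment> \<open>These events decrease to a null set by the strict inequality, so some
    \<open>A n\<close> has probability below \<open>\<beta> / 2\<close>.\<close>
  define A where "A n = {x \<in> space P. s x \<bullet> u > h - inverse (Suc n)}" for n
  have AE_less: "AE x in P. s x \<bullet> u < h"
    unfolding h_def using AE_inner_less[OF \<open>u \<noteq> 0\<close> True] .
  have [measurable]: "A n \<in> sets P" for n
    unfolding A_def by measurable
  have decs: "decseq A"
  proof (rule decseq_SucI)
    fix n
    have "inverse (real (Suc (Suc n))) \<le> inverse (real (Suc n))" by (simp add: field_simps)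
    then have "h - inverse (real (Suc n)) < z" if "h - inverse (real (Suc (Suc n))) < z" for z
      using that by linarith
    then show "A (Suc n) \<subseteq> A n" unfolding A_def by blast
  qed
  have "(\<lambda>n. measure P (A n)) \<longlonglongrightarrow> measure P (\<Inter>n. A n)"
    by (intro P.finite_Lim_measure_decseq decs) auto
  also have "measure P (\<Inter>n. A n) = measure P {}"
  proof (rule P.finite_measure_eq_AE)
    show "AE x in P. x \<in> (\<Inter>n. A n) \<longleftrightarrow> x \<in> {}"
      using AE_less
    proof eventually_elim
      case (elim x)
      then obtain n where "inverse (real (Suc n)) < h - s x \<bullet> u"
        using reals_Archimedean[of "h - s x \<bullet> u"] by auto
      then have "x \<notin> A n" by (auto simp: A_def)
      then show ?case by auto
    qed
  qed auto
  finally have "\<forall>\<^sub>F n in sequentially. measure P (A n) < \<beta> / 2"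
    using \<beta> by (intro order_tendstoD) auto
  then obtain n where n: "measure P (A n) < \<beta> / 2"
    by (auto simp: eventually_sequentially)
  define e where "e = inverse (real (Suc n))"
  have e: "e > 0" by (simp add: e_def)
  have "h - e / 2 < h" using e by simp
  then obtain m where m: "m \<in> Mom" "m \<bullet> u > h - e / 2"
    unfolding h_def using Th_nonempty True by (subst (asm) less_cSUP_iff) (auto simp: Mom_eq)
  \<comment> \<open>Then \<open>d - (m - s x) \<bullet> u = s x \<bullet> u - (h - e)\<close>, which
    is positive only on \<open>A n\<close> and almost surely at most \<open>e\<close> there. As
    \<open>d > e / 2\<close>, the mean deficit is below \<open>\<beta> * d\<close>.\<close>
  define d where "d = m \<bullet> u - (h - e)"
  have d: "d > e / 2" using m by (simp add: d_def)
  have int: "integrable P (\<lambda>x. e * indicator (A n) x)"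
    by (intro integrable_mult_right P.integrable_const_bound[of _ 1]) auto
  have le: "AE x in P. max 0 (d - (m - s x) \<bullet> u) \<le> e * indicator (A n) x"
    using AE_less AE_space
    by eventually_elim (use e in \<open>auto simp: d_def A_def e_def inner_diff_left indicator_def\<close>)
  have "(\<integral>x. max 0 (d - (m - s x) \<bullet> u) \<partial>P) \<le> (\<integral>x. e * indicator (A n) x \<partial>P)"
  proof (intro integral_mono_AE int le)
    show "integrable P (\<lambda>x. max 0 (d - (m - s x) \<bullet> u))"
      by (rule Bochner_Integration.integrable_bound[OF int]) (use le e in auto)
  qed
  also have "\<dots> = e * measure P (A n)" by simp
  also have "\<dots> \<le> e * (\<beta> / 2)" using n e by simp
  also have "\<dots> < \<beta> * d" using d \<beta> by (simp add: field_simps)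
  finally show ?thesis using m d e by (intro bexI[of _ m] exI[of _ d]) auto
next
  case False
  \<comment> \<open>If the supremum is infinite, any \<open>m\<close> with
    \<open>m \<bullet> u > n + 1\<close> and \<open>d = 1\<close> have a deficit of at most the
    positive part of \<open>s x \<bullet> u - n\<close>, whose mean tends to 0.\<close>
  have "(\<lambda>n. \<integral>x. max 0 (s x \<bullet> u - real n) \<partial>P) \<longlonglongrightarrow> (\<integral>x. 0 \<partial>P)"
  proof (rule integral_dominated_convergence[where w = "\<lambda>x. norm u * norm (s x)"])
    show "AE x in P. (\<lambda>n. max 0 (s x \<bullet> u - real n)) \<longlonglongrightarrow> 0"
    proof (intro AE_I2 tendsto_eventually)
      fix x
      obtain N where "s x \<bullet> u \<le> real N" using real_arch_simple by blast
      then show "\<forall>\<^sub>F n in sequentially. max 0 (s x \<bullet> u - real n) = 0"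
        by (auto simp: eventually_sequentially intro!: exI[of _ N])
    qed
    fix n
    have "s x \<bullet> u - real n \<le> norm u * norm (s x)" for x
      using norm_cauchy_schwarz[of "s x" u] by (simp add: mult.commute)
    then show "AE x in P. norm (max 0 (s x \<bullet> u - real n)) \<le> norm u * norm (s x)"
      by (auto intro!: AE_I2)
  qed (use s_integrable in auto)
  then have "\<forall>\<^sub>F n in sequentially. (\<integral>x. max 0 (s x \<bullet> u - real n) \<partial>P) < \<beta>"
    using \<beta> by (intro order_tendstoD(2)) auto
  then obtain n where n: "(\<integral>x. max 0 (s x \<bullet> u - real n) \<partial>P) < \<beta>"
    by (auto simp: eventually_sequentially)
  obtain m where m: "m \<in> Mom" "m \<bullet> u > real n + 1"
    using False by (auto simp: bdd_above_def not_le)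
  have su: "integrable P (\<lambda>x. s x \<bullet> u)"
    using s_integrable by (auto simp: integrable_norm_iff intro!: integrable_inner_left)
  have "(\<integral>x. max 0 (1 - (m - s x) \<bullet> u) \<partial>P) \<le> (\<integral>x. max 0 (s x \<bullet> u - real n) \<partial>P)"
    using m su by (intro integral_mono) (auto simp: inner_diff_left)
  then show ?thesis using n m by (intro bexI[of _ m] exI[of _ 1]) auto
qed

end

section \<open>Simultaneous control of all large subsets\<close>

locale iid_exponential_family_sample = exponential_family_sample XX lam s P + Om: prob_space Om
  for XX :: "(real^'d) set" and lam :: "(real^'d) measure" and s :: "real^'d \<Rightarrow> real^'k"
    and P :: "(real^'d) measure" and Om :: "'w measure" +
  fixes X :: "nat \<Rightarrow> 'w \<Rightarrow> real^'d"
  assumes X_indep: "prob_space.indep_vars Om (\<lambda>_. P) X {1..}"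
    and X_distr: "\<And>i. i \<ge> 1 \<Longrightarrow> distr Om P (X i) = P"
begin

lemmas AE_eventually_sum_le =
  Om.eventually_sum_iid_le[OF P.prob_space_axioms X_indep X_distr]

text \<open>The deficits over \<open>J\<close> sum to at most the sum of their positive parts over
  \<open>{1..n}\<close>, so one law of large numbers per direction serves all \<open>J\<close> at
  once. A finite net of the sphere suffices for the directions.\<close>

lemma AE_moments_dominate_subset_means:
  fixes \<beta> :: real
  assumes \<beta>: "\<beta> > 0"
  obtains F and a :: real where "finite F" "F \<subseteq> Mom" "a > 0"
    "AE w in Om. \<forall>\<^sub>F n in sequentially. \<forall>J\<subseteq>{1..n}. \<beta> * n \<le> card J \<longrightarrow>
       (\<forall>u. norm u = 1 \<longrightarrow> (\<exists>m\<in>F. a * card J \<le> (\<Sum>j\<in>J. (m - s (X j w)) \<bullet> u)))"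
proof -
  define B where "B = 2 * (\<integral>x. norm (s x) \<partial>P) + 1"
  have B: "B > 0"
    unfolding B_def by (intro add_nonneg_pos mult_nonneg_nonneg Bochner_Integration.integral_nonneg) auto
  \<comment> \<open>The law of large numbers doubles \<open>\<beta> / 4\<close> to
    \<open>\<beta> / 2\<close>; because \<open>\<beta> * n \<le> card J\<close>, this costs half of
    \<open>d\<close> on average over \<open>J\<close>.\<close>
  have "\<exists>m d. m \<in> Mom \<and> d > 0 \<and> (\<integral>x. max 0 (d - (m - s x) \<bullet> u) \<partial>P) < \<beta> / 4 * d"
    if "norm u = 1" for u
    using exists_moment_small_deficit[of u "\<beta> / 4"] that \<beta> by fastforce
  then obtain m d where md: "\<And>u. norm u = 1 \<Longrightarrow>
      m u \<in> Mom \<and> d u > 0 \<and> (\<integral>x. max 0 (d u - (m u - s x) \<bullet> u) \<partial>P) < \<beta> / 4 * d u"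
    by metis
  \<comment> \<open>\<open>B / \<beta>\<close> will bound the mean of
    \<open>norm (s (X j w))\<close> over \<open>J\<close>. Turning \<open>u\<close> by less than
    \<open>r u\<close> then costs at most \<open>d u / 4\<close> on average.\<close>
  define r where "r u = d u / 4 / (norm (m u) + B / \<beta>)" for u
  have pos: "norm (m u) + B / \<beta> > 0" for u
    using B \<beta> by (intro add_nonneg_pos) auto
  have r_mult: "(norm (m u) + B / \<beta>) * r u = d u / 4" for u
    unfolding r_def using pos[of u]
    by (metis less_irrefl nonzero_mult_div_cancel_left times_divide_eq_right)
  have r: "r u > 0" if "norm u = 1" for u
    unfolding r_def using md[OF that] pos[of u] by (intro divide_pos_pos) auto
  have "\<exists>C'\<subseteq>sphere 0 1. finite C' \<and> sphere 0 1 \<subseteq> (\<Union>u\<in>C'. ball u (r u))"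
  proof (rule compactE_image[of "sphere 0 1" "sphere 0 1" "\<lambda>u. ball u (r u)"])
    show "sphere 0 1 \<subseteq> (\<Union>u\<in>sphere 0 1. ball u (r u))"
      using r by force
  qed auto
  then obtain C' where C': "C' \<subseteq> sphere 0 1" "finite C'" "sphere 0 1 \<subseteq> (\<Union>u\<in>C'. ball u (r u))"
    by blast
  \<comment> \<open>The element 1 makes \<open>Min\<close> meaningful without a case distinction on
    \<open>C'\<close>.\<close>
  define a where "a = Min (insert 1 ((\<lambda>u. d u / 4) ` C'))"
  have a: "a > 0" unfolding a_def using C' md by (subst Min_gr_iff) auto
  have AE_norm: "AE w in Om. \<forall>\<^sub>F n in sequentially. (\<Sum>j\<in>{1..n}. norm (s (X j w))) \<le> n * B"
    by (rule AE_eventually_sum_le) (auto simp: B_def s_integrable)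
  have "AE w in Om. \<forall>\<^sub>F n in sequentially.
      (\<Sum>j\<in>{1..n}. max 0 (d u - (m u - s (X j w)) \<bullet> u)) \<le> n * (\<beta> / 2 * d u)" if "u \<in> C'" for u
  proof (rule AE_eventually_sum_le)
    have "integrable P s" using s_integrable by (simp add: integrable_norm_iff)
    then show "integrable P (\<lambda>x. max 0 (d u - (m u - s x) \<bullet> u))" by auto
    show "2 * (\<integral>x. max 0 (d u - (m u - s x) \<bullet> u) \<partial>P) < \<beta> / 2 * d u"
      using md[of u] that C' by auto
  qed auto
  then have "AE w in Om. \<forall>u\<in>C'. \<forall>\<^sub>F n in sequentially.
      (\<Sum>j\<in>{1..n}. max 0 (d u - (m u - s (X j w)) \<bullet> u)) \<le> n * (\<beta> / 2 * d u)"
    using C' by (intro AE_finite_allI) auto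
  then have "AE w in Om. \<forall>\<^sub>F n in sequentially. \<forall>J\<subseteq>{1..n}. \<beta> * n \<le> card J \<longrightarrow>
       (\<forall>u. norm u = 1 \<longrightarrow> (\<exists>m\<in>m ` C'. a * card J \<le> (\<Sum>j\<in>J. (m - s (X j w)) \<bullet> u)))"
    using AE_norm
  proof eventually_elim
    case (elim w)
    then have "\<forall>\<^sub>F n in sequentially. \<forall>u\<in>C'.
      (\<Sum>j\<in>{1..n}. max 0 (d u - (m u - s (X j w)) \<bullet> u)) \<le> n * (\<beta> / 2 * d u)"
      using C' by (intro eventually_ball_finite) auto
    then show ?case using elim(2)
    proof eventually_elim
      case (elim n)
      show ?case
      proof (intro allI impI)
        fix J v assume J: "J \<subseteq> {1..n}" "\<beta> * n \<le> card J" and v: "norm (v::real^'k) = 1"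
        have fin: "finite J" using J finite_subset by blast
        from v C' obtain u where u: "u \<in> C'" "norm u = 1" "dist u v < r u" by fastforce
        define N where "N = real (card J)"
        have "(\<Sum>j\<in>J. d u - (m u - s (X j w)) \<bullet> u)
            \<le> (\<Sum>j\<in>J. max 0 (d u - (m u - s (X j w)) \<bullet> u))"
          by (intro sum_mono) auto
        also have "\<dots> \<le> (\<Sum>j\<in>{1..n}. max 0 (d u - (m u - s (X j w)) \<bullet> u))"
          using J by (intro sum_mono2) auto
        also have "\<dots> \<le> n * (\<beta> / 2 * d u)" using elim u by blast
        also have "\<dots> \<le> N * d u / 2"
          using J md[OF u(2)] mult_right_mono[of "\<beta> * n" N "d u"] by (simp add: N_def mult_ac)
        finally have 1: "(\<Sum>j\<in>J. (m u - s (X j w)) \<bullet> u) \<ge> N * d u / 2"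
          by (simp add: sum_subtractf N_def mult.commute)
        have "(\<Sum>j\<in>J. (m u - s (X j w)) \<bullet> (u - v)) \<le> (\<Sum>j\<in>J. (norm (m u) + norm (s (X j w))) * r u)"
        proof (rule sum_mono)
          fix j
          have "(m u - s (X j w)) \<bullet> (u - v) \<le> norm (m u - s (X j w)) * norm (u - v)"
            by (rule norm_cauchy_schwarz)
          also have "\<dots> \<le> (norm (m u) + norm (s (X j w))) * r u"
            using u by (intro mult_mono norm_triangle_ineq4) (auto simp: dist_norm)
          finally show "(m u - s (X j w)) \<bullet> (u - v) \<le> (norm (m u) + norm (s (X j w))) * r u" .
        qed
        also have "\<dots> = (N * norm (m u) + (\<Sum>j\<in>J. norm (s (X j w)))) * r u"
          by (simp add: sum_distrib_right[symmetric] sum.distrib N_def)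
        also have "\<dots> \<le> (N * norm (m u) + N * (B / \<beta>)) * r u"
        proof (intro mult_right_mono add_left_mono)
          have "(\<Sum>j\<in>J. norm (s (X j w))) \<le> (\<Sum>j\<in>{1..n}. norm (s (X j w)))"
            using J by (intro sum_mono2) auto
          also have "\<dots> \<le> n * B" using elim by blast
          also have "\<dots> \<le> N * (B / \<beta>)"
            using J B \<beta> mult_right_mono[of "\<beta> * n" N B] by (simp add: N_def field_simps)
          finally show "(\<Sum>j\<in>J. norm (s (X j w))) \<le> N * (B / \<beta>)" .
        qed (use r u in \<open>auto intro: less_imp_le\<close>)
        also have "\<dots> = N * ((norm (m u) + B / \<beta>) * r u)" by (simp add: algebra_simps)
        also have "\<dots> = N * d u / 4" by (simp only: r_mult times_divide_eq_right)
        finally have 2: "(\<Sum>j\<in>J. (m u - s (X j w)) \<bullet> (u - v)) \<le> N * d u / 4" .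
        \<comment> \<open>Of \<open>d u\<close>, one half is lost to the deficit and a quarter to
          the change of direction; \<open>a\<close> is at most the remaining quarter.\<close>
        have "a * N \<le> d u / 4 * N"
          unfolding a_def using C' u by (intro mult_right_mono Min_le) (auto simp: N_def)
        also have "\<dots> \<le> (\<Sum>j\<in>J. (m u - s (X j w)) \<bullet> v)"
          using 1 2 by (simp add: inner_diff_right sum_subtractf mult.commute[of "d u"])
        finally show "\<exists>m\<in>m ` C'. a * card J \<le> (\<Sum>j\<in>J. (m - s (X j w)) \<bullet> v)"
          using u by (auto simp: N_def)
      qed
    qed
  qed
  then show ?thesis
    using C' md a by (intro that[of "m ` C'" a]) (auto dest!: subsetD)
qed

end

section \<open>Concentration of the posterior\<close>

locale exponential_family_prior = exponential_family XX lam s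
  for XX :: "(real^'d) set" and lam :: "(real^'d) measure" and s :: "real^'d \<Rightarrow> real^'k" +
  fixes \<xi> :: "real^'k" and \<nu> :: real
  assumes \<nu>_pos: "\<nu> > 0"
    and marginal_finite: "\<And>n J x. J \<subseteq> {1..n} \<Longrightarrow> (\<And>j. j \<in> J \<Longrightarrow> x j \<in> XX) \<Longrightarrow>
      marginal lam s \<xi> \<nu> x J < \<infinity>"
begin

abbreviation prior :: "real^'k \<Rightarrow> real" where "prior \<equiv> conj_prior lam s \<xi> \<nu>"

text \<open>The unnormalised posterior density of the parameter given the observations in
  \<open>J\<close>.\<close>

definition joint :: "(nat \<Rightarrow> real^'d) \<Rightarrow> nat set \<Rightarrow> real^'k \<Rightarrow> ennreal" where
  "joint x J \<theta> = ennreal ((\<Prod>j\<in>J. dens \<theta> (x j)) * prior \<theta>) * indicator Th \<theta>"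

lemma prior_nonneg: "prior \<theta> \<ge> 0"
  by (simp add: conj_prior_def)

lemma prior_eq: "\<theta> \<in> Th \<Longrightarrow> prior \<theta> = exp (\<xi> \<bullet> \<theta> - \<nu> * \<kappa> \<theta> - psi lam s \<xi> \<nu>)"
  by (simp add: conj_prior_def)

text \<open>\<open>\<kappa>\<close> is arbitrary off \<open>Th\<close>, so measurability comes from
  continuity on the open set \<open>Th\<close> combined with the indicator.\<close>

lemma joint_measurable[measurable]: "joint x J \<in> borel_measurable borel"
proof -
  have "continuous_on Th (\<lambda>\<theta>. (\<Prod>j\<in>J. dens \<theta> (x j)) * exp (\<xi> \<bullet> \<theta> - \<nu> * \<kappa> \<theta> - psi lam s \<xi> \<nu>))"
    unfolding expfam_density_def by (intro continuous_intros kappa_continuous)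
  then have "continuous_on Th (\<lambda>\<theta>. (\<Prod>j\<in>J. dens \<theta> (x j)) * prior \<theta>)"
    by (simp add: prior_eq cong: continuous_on_cong)
  then have "(\<lambda>\<theta>. indicator Th \<theta> *\<^sub>R ((\<Prod>j\<in>J. dens \<theta> (x j)) * prior \<theta>)) \<in> borel_measurable borel"
    using open_Th by (intro borel_measurable_continuous_on_indicator) auto
  then have "(\<lambda>\<theta>. ennreal (indicator Th \<theta> *\<^sub>R ((\<Prod>j\<in>J. dens \<theta> (x j)) * prior \<theta>))) \<in> borel_measurable borel"
    by measurable
  also have "(\<lambda>\<theta>. ennreal (indicator Th \<theta> *\<^sub>R ((\<Prod>j\<in>J. dens \<theta> (x j)) * prior \<theta>))) = joint x J"
    by (auto simp: joint_def indicator_def)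
  finally show ?thesis .
qed

lemma marginal_eq: "J \<noteq> {} \<Longrightarrow> marginal lam s \<xi> \<nu> x J = (\<integral>\<^sup>+\<theta>. joint x J \<theta> \<partial>lborel)"
  by (simp add: marginal_def joint_def)

lemma prod_dens: "(\<Prod>j\<in>J. dens \<theta> (x j)) = exp ((\<Sum>j\<in>J. s (x j)) \<bullet> \<theta> - card J * \<kappa> \<theta>)"
  by (cases "finite J")
    (simp_all add: expfam_density_def exp_sum[symmetric] sum_subtractf inner_sum_left
      inner_commute[of \<theta> "s _"])

text \<open>Provides a compact ball of parameters over which integrals can be bounded from
  below.\<close>

lemma kappa_bounded_on_cball:
  obtains r \<theta>0 K where "r > 0" "cball \<theta>0 r \<subseteq> Th" "K \<ge> 0"
    "\<forall>\<theta>\<in>cball \<theta>0 r. \<bar>\<kappa> \<theta>\<bar> \<le> K"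
proof -
  obtain \<theta>0 r where \<theta>0: "r > 0" "cball \<theta>0 r \<subseteq> Th"
    using open_Th Th_nonempty open_contains_cball by blast
  have "bounded (\<kappa> ` cball \<theta>0 r)"
    using \<theta>0 by (intro compact_imp_bounded compact_continuous_image
        continuous_on_subset[OF kappa_continuous]) auto
  then obtain K where "\<forall>\<theta>\<in>cball \<theta>0 r. \<bar>\<kappa> \<theta>\<bar> \<le> K"
    unfolding bounded_iff by auto
  moreover have "K \<ge> 0" using bspec[OF calculation, of \<theta>0] \<theta>0 by simp
  ultimately show ?thesis using \<theta>0 that by blast
qed

text \<open>The tangent plane at a parameter \<open>\<theta>0\<close> with mean \<open>m\<close>
  leaves the constant \<open>m \<bullet> \<theta>0 - \<kappa> \<theta>0\<close>; summing absolute
  values gives one constant for all of \<open>F\<close>.\<close>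

lemma kappa_ge_affine:
  assumes "finite F" "F \<subseteq> Mom"
  obtains C :: real where "C \<ge> 0" "\<And>m \<theta>. m \<in> F \<Longrightarrow> \<theta> \<in> Th \<Longrightarrow> \<kappa> \<theta> \<ge> m \<bullet> \<theta> - C"
proof -
  have "\<exists>C. \<forall>\<theta>\<in>Th. \<kappa> \<theta> \<ge> m \<bullet> \<theta> - C" if m: "m \<in> F" for m
  proof -
    obtain \<theta>0 where \<theta>0: "\<theta>0 \<in> Th" "m = mean \<theta>0"
      using m assms by (auto simp: Mom_eq)
    have "\<kappa> \<theta> \<ge> m \<bullet> \<theta> - (m \<bullet> \<theta>0 - \<kappa> \<theta>0)" if "\<theta> \<in> Th" for \<theta>
      using kappa_tangent[OF that \<theta>0(1)] \<theta>0 by (simp add: inner_diff_right)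
    then show ?thesis by blast
  qed
  then obtain c where c: "\<And>m \<theta>. m \<in> F \<Longrightarrow> \<theta> \<in> Th \<Longrightarrow> \<kappa> \<theta> \<ge> m \<bullet> \<theta> - c m" by metis
  define C where "C = (\<Sum>m\<in>F. \<bar>c m\<bar>)"
  have "c m \<le> C" if "m \<in> F" for m
    using member_le_sum[of m F "\<lambda>m. \<bar>c m\<bar>"] that assms by (auto simp: C_def)
  then show ?thesis using c
    by (intro that[of C]) (force simp: C_def intro: sum_nonneg)+
qed

text \<open>
  Relative to the one-point integrand of \<open>x0\<close>, which is integrable, the integrand of a large
  set \<open>J\<close> decays like \<open>exp (- a |J| |\<theta>| / 2)\<close>, uniformly in \<open>J\<close>. Hence a fixed ball carries
  at least half of the mass.
\<close>

lemma marginal_concentrates: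
  fixes a B :: real
  assumes F: "finite F" "F \<subseteq> Mom" and a: "a > 0" and B: "B \<ge> 0"
  obtains \<rho> :: real and N :: nat where "\<rho> \<ge> 0"
    "\<And>x J. \<lbrakk>finite J; N \<le> card J; (\<Sum>j\<in>J. norm (s (x j))) \<le> B * card J;
       \<And>u. norm u = 1 \<Longrightarrow> \<exists>m\<in>F. a * card J \<le> (\<Sum>j\<in>J. (m - s (x j)) \<bullet> u)\<rbrakk> \<Longrightarrow>
       marginal lam s \<xi> \<nu> x J \<le> 2 * (\<integral>\<^sup>+\<theta>. joint x J \<theta> * indicator (cball 0 \<rho>) \<theta> \<partial>lborel)"
proof -
  obtain C where C: "C \<ge> 0" "\<And>m \<theta>. m \<in> F \<Longrightarrow> \<theta> \<in> Th \<Longrightarrow> \<kappa> \<theta> \<ge> m \<bullet> \<theta> - C"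
    using kappa_ge_affine[OF F] by blast
  obtain x0 where x0: "x0 \<in> XX" using XX_nonempty by blast
  \<comment> \<open>The integrand for one artificial observation: a finite reference measure that
    does not depend on the sample.\<close>
  define q where "q = joint (\<lambda>_. x0) {1}"
  have q_meas[measurable]: "q \<in> borel_measurable borel" by (simp add: q_def)
  have q_eq: "q \<theta> = ennreal (dens \<theta> x0 * prior \<theta>)" if "\<theta> \<in> Th" for \<theta>
    using that by (simp add: q_def joint_def)
  have q_fin: "(\<integral>\<^sup>+\<theta>. q \<theta> \<partial>lborel) < \<infinity>"
    using marginal_finite[of "{1}" 1 "\<lambda>_. x0"] x0 by (simp add: q_def marginal_eq)
  obtain r \<theta>0 K where \<theta>0: "r > 0" "cball \<theta>0 r \<subseteq> Th"
    and "K \<ge> 0" and K: "\<forall>\<theta>\<in>cball \<theta>0 r. \<bar>\<kappa> \<theta>\<bar> \<le> K"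
    using kappa_bounded_on_cball .
  have [measurable]: "cball \<theta>0 r \<in> sets borel" by simp
  have pos: "(\<integral>\<^sup>+\<theta>. q \<theta> * indicator (cball \<theta>0 r) \<theta> \<partial>lborel) \<noteq> 0"
  proof
    assume "(\<integral>\<^sup>+\<theta>. q \<theta> * indicator (cball \<theta>0 r) \<theta> \<partial>lborel) = 0"
    then have "AE \<theta> in lborel. q \<theta> * indicator (cball \<theta>0 r) \<theta> = 0"
      by (subst (asm) nn_integral_0_iff_AE) measurable
    moreover have "q \<theta> \<noteq> 0" if "\<theta> \<in> cball \<theta>0 r" for \<theta>
    proof -
      have "\<theta> \<in> Th" using that \<theta>0 by blast
      then show ?thesis using dens_pos[of \<theta> x0] by (simp add: q_eq prior_eq)
    qed
    ultimately have "AE \<theta> in lborel. \<theta> \<notin> cball \<theta>0 r"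
      by (auto simp: indicator_def elim!: eventually_mono)
    then have "cball \<theta>0 r \<in> null_sets lborel"
      by (subst AE_iff_null_sets) auto
    then have "emeasure lborel (cball \<theta>0 r) = 0" by auto
    then show False
      using \<theta>0 unit_ball_vol_pos[of "real CARD('k)"] by (simp add: emeasure_cball)
  qed
  define I0 where "I0 = enn2real (\<integral>\<^sup>+\<theta>. q \<theta> \<partial>lborel)"
  define b0 where "b0 = enn2real (\<integral>\<^sup>+\<theta>. q \<theta> * indicator (cball \<theta>0 r) \<theta> \<partial>lborel)"
  have ball_fin: "(\<integral>\<^sup>+\<theta>. q \<theta> * indicator (cball \<theta>0 r) \<theta> \<partial>lborel) < \<infinity>"
    by (rule le_less_trans[OF nn_integral_mono q_fin]) (auto simp: indicator_def)
  have I0: "(\<integral>\<^sup>+\<theta>. q \<theta> \<partial>lborel) = ennreal I0" "I0 \<ge> 0"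
    using q_fin by (auto simp: I0_def)
  have b0: "(\<integral>\<^sup>+\<theta>. q \<theta> * indicator (cball \<theta>0 r) \<theta> \<partial>lborel) = ennreal b0" "b0 > 0"
    using ball_fin pos by (auto simp: b0_def enn2real_positive_iff zero_less_iff_neq_zero)
  define T where "T = norm \<theta>0 + r"
  have T: "norm \<theta> \<le> T" if "\<theta> \<in> cball \<theta>0 r" for \<theta>
    using that norm_triangle_sub[of \<theta> \<theta>0] by (simp add: T_def dist_norm norm_minus_commute)
  have "T \<ge> 0" using \<theta>0 by (simp add: T_def)
  \<comment> \<open>\<open>S\<close> bounds \<open>norm (m - s x0)\<close>, \<open>n * D\<close>
    bounds \<open>- rest \<theta>\<close> on the small ball, and \<open>L\<close> is the ratio of
    the total mass of \<open>q\<close> to its mass on that ball.\<close>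
  define S where "S = (\<Sum>m\<in>F. norm m) + norm (s x0)"
  define D where "D = T * B + T * norm (s x0) + 2 * K"
  define L where "L = I0 / b0"
  \<comment> \<open>The first summand gives \<open>a * \<rho> / 2 - C \<ge> D + L\<close>, the decay
    needed per observation; adding \<open>T\<close> puts the small ball inside
    \<open>cball 0 \<rho>\<close>.\<close>
  define \<rho> where "\<rho> = 2 * (C + D + L) / a + T"
  have "D \<ge> 0" "L \<ge> 0"
    using \<open>T \<ge> 0\<close> \<open>K \<ge> 0\<close> B I0 b0 by (auto simp: D_def L_def)
  then have \<rho>: "\<rho> \<ge> T" "a * \<rho> / 2 - C \<ge> D + L"
    using a C \<open>T \<ge> 0\<close> by (auto simp: \<rho>_def field_simps)
  \<comment> \<open>Once \<open>card J > N0\<close>, the error \<open>S * norm \<theta>\<close> due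
    to the reference point uses up at most half of the decay
    \<open>a * n * norm \<theta>\<close>.\<close>
  obtain N0 :: nat where N0: "2 * S / a \<le> N0" using real_arch_simple by blast
  show ?thesis
  proof (rule that[of \<rho> "Suc N0"])
    show "\<rho> \<ge> 0" using \<rho> \<open>T \<ge> 0\<close> by simp
    fix x :: "nat \<Rightarrow> real^'d" and J
    assume J: "finite J" "Suc N0 \<le> card J"
      and sum_le: "(\<Sum>j\<in>J. norm (s (x j))) \<le> B * card J"
      and dom: "\<And>u. norm u = 1 \<Longrightarrow> \<exists>m\<in>F. a * card J \<le> (\<Sum>j\<in>J. (m - s (x j)) \<bullet> u)"
    define n where "n = real (card J)"
    have n: "n \<ge> 1" "2 * S \<le> a * n"
      using J N0 a by (auto simp: n_def field_simps) (use mult_left_mono[of "real N0" "real (card J)" a] in linarith)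
    have "J \<noteq> {}" using J by auto
    define y where "y = (\<Sum>j\<in>J. s (x j))"
    \<comment> \<open>The logarithm of the ratio of \<open>joint x J \<theta>\<close> to
      \<open>q \<theta>\<close>. One normalising factor is absorbed by \<open>q\<close>, hence
      \<open>n - 1\<close>.\<close>
    define rest where "rest \<theta> = (y - s x0) \<bullet> \<theta> - (n - 1) * \<kappa> \<theta>" for \<theta>
    have joint_eq: "joint x J \<theta> = ennreal (exp (rest \<theta>)) * q \<theta>" if "\<theta> \<in> Th" for \<theta>
    proof -
      have "(\<Prod>j\<in>J. dens \<theta> (x j)) = exp (rest \<theta>) * dens \<theta> x0"
        unfolding prod_dens
        by (simp add: expfam_density_def rest_def y_def n_def exp_add[symmetric] algebra_simps inner_commute)
      then show ?thesis using that prior_nonneg dens_pos[of \<theta> x0]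
        by (simp add: joint_def q_eq ennreal_mult[symmetric] mult_ac)
    qed
    have joint_0: "joint x J \<theta> = 0" if "\<theta> \<notin> Th" for \<theta> using that by (simp add: joint_def)
    have ball: "rest \<theta> \<ge> - (n * D)" if "\<theta> \<in> cball \<theta>0 r" for \<theta>
    proof -
      have "norm (y - s x0) \<le> norm y + norm (s x0)" by (rule norm_triangle_ineq4)
      also have "norm y \<le> B * n"
        unfolding y_def n_def using sum_le by (rule order_trans[OF norm_sum])
      also have "norm (s x0) \<le> norm (s x0) * n"
        using n mult_left_mono[of 1 n "norm (s x0)"] by simp
      finally have "norm (y - s x0) * norm \<theta> \<le> (B * n + norm (s x0) * n) * T"
        using T[OF that] B n by (intro mult_mono) auto
      moreover have "- ((y - s x0) \<bullet> \<theta>) \<le> norm (y - s x0) * norm \<theta>"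
        using norm_cauchy_schwarz[of "- (y - s x0)" \<theta>] by (simp add: inner_diff_left norm_minus_commute)
      moreover have "(n - 1) * \<kappa> \<theta> \<le> (n - 1) * K"
        using bspec[OF K that] n by (intro mult_left_mono) auto
      moreover have "(n - 1) * K \<le> n * (2 * K)"
        using n \<open>K \<ge> 0\<close> by (intro mult_mono) auto
      ultimately show ?thesis by (simp add: rest_def D_def algebra_simps)
    qed
    \<comment> \<open>\<open>m\<close> is chosen for the direction of \<open>\<theta>\<close>
      itself. With \<open>\<kappa> \<theta> \<ge> m \<bullet> \<theta> - C\<close>, the exponent is
      at most \<open>n * C + S * norm \<theta> - a * n * norm \<theta>\<close>.\<close>
    have tail: "rest \<theta> \<le> - (n * (D + L))" if "\<theta> \<in> Th" "norm \<theta> > \<rho>" for \<theta>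
    proof -
      have norm_pos: "norm \<theta> > 0" using that \<open>\<rho> \<ge> 0\<close> by linarith
      then obtain m where m: "m \<in> F" "a * n \<le> (\<Sum>j\<in>J. (m - s (x j)) \<bullet> (\<theta> /\<^sub>R norm \<theta>))"
        using dom[of "\<theta> /\<^sub>R norm \<theta>"] by (auto simp: n_def)
      have "(\<Sum>j\<in>J. (m - s (x j)) \<bullet> (\<theta> /\<^sub>R norm \<theta>)) = (\<Sum>j\<in>J. (m - s (x j)) \<bullet> \<theta>) / norm \<theta>"
        by (simp add: sum_distrib_left divide_inverse mult.commute)
      also have "(\<Sum>j\<in>J. (m - s (x j)) \<bullet> \<theta>) = n * (m \<bullet> \<theta>) - y \<bullet> \<theta>"
        by (simp add: inner_diff_left sum_subtractf n_def y_def inner_sum_left)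
      finally have "a * n * norm \<theta> \<le> n * (m \<bullet> \<theta>) - y \<bullet> \<theta>"
        using m norm_pos by (simp add: pos_le_divide_eq)
      moreover have "(n - 1) * \<kappa> \<theta> \<ge> (n - 1) * (m \<bullet> \<theta> - C)"
        using C(2)[OF m(1) that(1)] n by (intro mult_left_mono) auto
      moreover have "(m - s x0) \<bullet> \<theta> \<le> S * norm \<theta>"
      proof -
        have "norm m \<le> (\<Sum>m\<in>F. norm m)"
          using member_le_sum[of m F norm] m F by auto
        then have "norm (m - s x0) \<le> S"
          using norm_triangle_ineq4[of m "s x0"] by (simp add: S_def)
        then show ?thesis
          using norm_cauchy_schwarz[of "m - s x0" \<theta>] mult_right_mono[of "norm (m - s x0)" S "norm \<theta>"]
          by auto
      qed
      moreover have "S * norm \<theta> \<le> a * n / 2 * norm \<theta>"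
        using n by (intro mult_right_mono) auto
      ultimately have "rest \<theta> \<le> n * C - a * n * norm \<theta> / 2"
        using C(1) by (simp add: rest_def algebra_simps)
      also have "\<dots> \<le> n * C - a * n * \<rho> / 2"
        using that a n by (simp add: mult_left_mono)
      also have "\<dots> = - (n * (a * \<rho> / 2 - C))" by (simp add: algebra_simps)
      also have "\<dots> \<le> - (n * (D + L))"
        using \<rho> n by (simp add: mult_left_mono)
      finally show ?thesis .
    qed
    have "(\<integral>\<^sup>+\<theta>. joint x J \<theta> * indicator (- cball 0 \<rho>) \<theta> \<partial>lborel)
        \<le> (\<integral>\<^sup>+\<theta>. ennreal (exp (- (n * (D + L)))) * q \<theta> \<partial>lborel)"
    proof (rule nn_integral_mono)
      fix \<theta>
      show "joint x J \<theta> * indicator (- cball 0 \<rho>) \<theta> \<le> ennreal (exp (- (n * (D + L)))) * q \<theta>"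
        using tail[of \<theta>]
        by (cases "\<theta> \<in> Th"; cases "norm \<theta> > \<rho>")
          (auto simp: joint_eq joint_0 indicator_def intro!: mult_right_mono ennreal_leI)
    qed
    also have "\<dots> = ennreal (exp (- (n * (D + L))) * I0)"
      by (simp add: nn_integral_cmult I0 ennreal_mult[symmetric])
    also have "\<dots> \<le> ennreal (exp (- (n * D)) * b0)"
    proof (rule ennreal_leI)
      \<comment> \<open>Since \<open>I0 = L * b0\<close>, the bound
        \<open>exp (- L) * L \<le> 1\<close> trades the total mass of \<open>q\<close> for its mass
        on the small ball.\<close>
      have "L \<le> exp L" using exp_ge_add_one_self[of L] by linarith
      have "exp (- (n * (D + L))) \<le> exp (- (n * D) - L)"
        using n \<open>L \<ge> 0\<close> mult_right_mono[of 1 n L] by (simp add: distrib_left)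
      then have "exp (- (n * (D + L))) * I0 \<le> exp (- (n * D) - L) * I0"
        using I0 by (intro mult_right_mono)
      also have "\<dots> = exp (- (n * D)) * (exp (- L) * L) * b0"
        using b0 by (simp add: L_def exp_diff exp_minus divide_inverse)
      also have "\<dots> \<le> exp (- (n * D)) * 1 * b0"
        using b0 \<open>L \<le> exp L\<close>
        by (intro mult_right_mono mult_left_mono) (auto simp: exp_minus divide_simps)
      finally show "exp (- (n * (D + L))) * I0 \<le> exp (- (n * D)) * b0" by simp
    qed
    also have "\<dots> = (\<integral>\<^sup>+\<theta>. ennreal (exp (- (n * D))) * (q \<theta> * indicator (cball \<theta>0 r) \<theta>) \<partial>lborel)"
      using b0 by (subst nn_integral_cmult) (auto simp: ennreal_mult)
    also have "\<dots> \<le> (\<integral>\<^sup>+\<theta>. joint x J \<theta> * indicator (cball 0 \<rho>) \<theta> \<partial>lborel)"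
    proof (rule nn_integral_mono)
      fix \<theta>
      show "ennreal (exp (- (n * D))) * (q \<theta> * indicator (cball \<theta>0 r) \<theta>)
          \<le> joint x J \<theta> * indicator (cball 0 \<rho>) \<theta>"
      proof (cases "\<theta> \<in> cball \<theta>0 r")
        case True
        then have "\<theta> \<in> Th" "\<theta> \<in> cball 0 \<rho>" using \<theta>0 T[of \<theta>] \<rho> by auto
        then show ?thesis using True ball[OF True]
          by (auto simp: joint_eq intro!: mult_right_mono ennreal_leI)
      qed simp
    qed
    finally have le: "(\<integral>\<^sup>+\<theta>. joint x J \<theta> * indicator (- cball 0 \<rho>) \<theta> \<partial>lborel)
        \<le> (\<integral>\<^sup>+\<theta>. joint x J \<theta> * indicator (cball 0 \<rho>) \<theta> \<partial>lborel)" .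
    have [measurable]: "cball (0 :: real^'k) \<rho> \<in> sets borel" by simp
    have "marginal lam s \<xi> \<nu> x J = (\<integral>\<^sup>+\<theta>. joint x J \<theta> * indicator (cball 0 \<rho>) \<theta>
        + joint x J \<theta> * indicator (- cball 0 \<rho>) \<theta> \<partial>lborel)"
      unfolding marginal_eq[OF \<open>J \<noteq> {}\<close>]
      by (intro nn_integral_cong) (simp split: split_indicator)
    also have "(\<integral>\<^sup>+\<theta>. joint x J \<theta> * indicator (cball 0 \<rho>) \<theta>
        + joint x J \<theta> * indicator (- cball 0 \<rho>) \<theta> \<partial>lborel)
        = (\<integral>\<^sup>+\<theta>. joint x J \<theta> * indicator (cball 0 \<rho>) \<theta> \<partial>lborel)
        + (\<integral>\<^sup>+\<theta>. joint x J \<theta> * indicator (- cball 0 \<rho>) \<theta> \<partial>lborel)"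
      by (intro nn_integral_add) measurable
    also have "\<dots> \<le> 2 * (\<integral>\<^sup>+\<theta>. joint x J \<theta> * indicator (cball 0 \<rho>) \<theta> \<partial>lborel)"
      using le by (simp add: mult_2)
    finally show "marginal lam s \<xi> \<nu> x J
        \<le> 2 * (\<integral>\<^sup>+\<theta>. joint x J \<theta> * indicator (cball 0 \<rho>) \<theta> \<partial>lborel)" .
  qed
qed

text \<open>On a fixed ball of parameters both the density and the prior are bounded below,
  uniformly over observations with statistic of norm at most \<open>R\<close>.\<close>

lemma marginal_singleton_lower_bound:
  obtains b :: real where "b > 0" "\<And>x j. norm (s (x j)) \<le> R \<Longrightarrow> ennreal b \<le> marginal lam s \<xi> \<nu> x {j}"
proof -
  obtain r \<theta>0 K where \<theta>0: "r > 0" "cball \<theta>0 r \<subseteq> Th"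
    and "K \<ge> 0" and K: "\<forall>\<theta>\<in>cball \<theta>0 r. \<bar>\<kappa> \<theta>\<bar> \<le> K"
    using kappa_bounded_on_cball .
  define T where "T = norm \<theta>0 + r"
  have T: "norm \<theta> \<le> T" if "\<theta> \<in> cball \<theta>0 r" for \<theta>
    using that norm_triangle_sub[of \<theta> \<theta>0] by (simp add: T_def dist_norm norm_minus_commute)
  \<comment> \<open>The first factor bounds the density from below on the ball, the second the
    prior.\<close>
  define c where "c = exp (- (T * R) - K) * exp (- (norm \<xi> * T) - \<nu> * K - psi lam s \<xi> \<nu>)"
  have c: "c > 0" by (simp add: c_def)
  obtain V where V: "emeasure lborel (cball \<theta>0 r) = ennreal V" "V > 0"
    using \<theta>0 unit_ball_vol_pos[of "real CARD('k)"] by (simp add: emeasure_cball)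
  show ?thesis
  proof (rule that[of "c * V"])
    show "c * V > 0" using c V by simp
    fix x :: "nat \<Rightarrow> real^'d" and j assume R: "norm (s (x j)) \<le> R"
    have "ennreal (c * V) = (\<integral>\<^sup>+\<theta>. ennreal c * indicator (cball \<theta>0 r) \<theta> \<partial>lborel)"
      using c V by (simp add: nn_integral_cmult_indicator ennreal_mult)
    also have "\<dots> \<le> (\<integral>\<^sup>+\<theta>. joint x {j} \<theta> \<partial>lborel)"
    proof (rule nn_integral_mono)
      fix \<theta>
      show "ennreal c * indicator (cball \<theta>0 r) \<theta> \<le> joint x {j} \<theta>"
      proof (cases "\<theta> \<in> cball \<theta>0 r")
        case True
        then have "\<theta> \<in> Th" using \<theta>0 by blast
        have "norm \<theta> * norm (s (x j)) \<le> T * R"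
          using R T[OF True] by (intro mult_mono) (auto intro: order_trans[OF norm_ge_zero])
        then have "- (\<theta> \<bullet> s (x j)) \<le> T * R"
          using norm_cauchy_schwarz[of "- \<theta>" "s (x j)"] by simp
        moreover have "norm \<xi> * norm \<theta> \<le> norm \<xi> * T"
          using T[OF True] by (intro mult_left_mono) auto
        then have "- (\<xi> \<bullet> \<theta>) \<le> norm \<xi> * T"
          using norm_cauchy_schwarz[of "- \<xi>" "\<theta>"] by simp
        moreover have "\<nu> * \<kappa> \<theta> \<le> \<nu> * K"
          using bspec[OF K True] \<nu>_pos by (intro mult_left_mono) auto
        ultimately have "c \<le> dens \<theta> (x j) * prior \<theta>"
          using bspec[OF K True] \<open>\<theta> \<in> Th\<close> unfolding c_def
          by (intro mult_mono) (auto simp: expfam_density_def prior_eq)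
        then show ?thesis using \<open>\<theta> \<in> Th\<close> True by (simp add: joint_def ennreal_leI)
      qed simp
    qed
    finally show "ennreal (c * V) \<le> marginal lam s \<xi> \<nu> x {j}" by (simp add: marginal_eq)
  qed
qed

text \<open>On the ball carrying half of the posterior mass, the density at \<open>x j\<close> is at
  most \<open>exp K\<close>. Replacing it by this bound leaves the integrand of
  \<open>J - {j}\<close>, and \<open>marginal_singleton_lower_bound\<close> pays for the marginal of
  \<open>{j}\<close>.\<close>

lemma marginal_le_marginal_remove:
  fixes a B R :: real
  assumes F: "finite F" "F \<subseteq> Mom" and a: "a > 0" and B: "B \<ge> 0"
  obtains c :: real and N :: nat where "c \<ge> 0"
    "\<And>x J j. \<lbrakk>finite J; N \<le> card J; j \<in> J; norm (s (x j)) \<le> R;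
       (\<Sum>j\<in>J. norm (s (x j))) \<le> B * card J;
       \<And>u. norm u = 1 \<Longrightarrow> \<exists>m\<in>F. a * card J \<le> (\<Sum>j\<in>J. (m - s (x j)) \<bullet> u)\<rbrakk> \<Longrightarrow>
       marginal lam s \<xi> \<nu> x J \<le> ennreal c * marginal lam s \<xi> \<nu> x (J - {j}) * marginal lam s \<xi> \<nu> x {j}"
proof -
  obtain \<rho> N where \<rho>: "\<rho> \<ge> 0" and conc:
    "\<And>x J. \<lbrakk>finite J; N \<le> card J; (\<Sum>j\<in>J. norm (s (x j))) \<le> B * card J;
       \<And>u. norm u = 1 \<Longrightarrow> \<exists>m\<in>F. a * card J \<le> (\<Sum>j\<in>J. (m - s (x j)) \<bullet> u)\<rbrakk> \<Longrightarrow>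
       marginal lam s \<xi> \<nu> x J \<le> 2 * (\<integral>\<^sup>+\<theta>. joint x J \<theta> * indicator (cball 0 \<rho>) \<theta> \<partial>lborel)"
    using marginal_concentrates[OF F a B] by blast
  obtain b where b: "b > 0" "\<And>x j. norm (s (x j)) \<le> R \<Longrightarrow> ennreal b \<le> marginal lam s \<xi> \<nu> x {j}"
    using marginal_singleton_lower_bound by blast
  obtain \<theta>0 where \<theta>0: "\<theta>0 \<in> Th" using Th_nonempty by blast
  define m where "m = mean \<theta>0"
  obtain C where C: "\<And>\<theta>. \<theta> \<in> Th \<Longrightarrow> \<kappa> \<theta> \<ge> m \<bullet> \<theta> - C"
    using kappa_ge_affine[of "{m}"] \<theta>0 unfolding m_def Mom_eq
    by (metis empty_subsetI finite.emptyI finite.insertI image_eqI insertI1 insert_subset)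
  \<comment> \<open>Bounds the log density on \<open>Th \<inter> cball 0 \<rho>\<close>. The ball
    may leave \<open>Th\<close>, where continuity of \<open>\<kappa>\<close> gives no bound, so an
    affine minorant is used.\<close>
  define K where "K = \<rho> * R + norm m * \<rho> + C"
  \<comment> \<open>The 2 accounts for the half of the mass outside the ball, and \<open>b\<close>
    is the lower bound for the marginal of \<open>{j}\<close>.\<close>
  define c where "c = 2 * exp K / b"
  show ?thesis
  \<comment> \<open>The 2 keeps \<open>J - {j}\<close> nonempty, so that its marginal is an integral
    and not the value 1 fixed by definition.\<close>
  proof (rule that[of c "max 2 N"])
    show "c \<ge> 0" using b by (simp add: c_def)
    fix x :: "nat \<Rightarrow> real^'d" and J j
    assume J: "finite J" "max 2 N \<le> card J" "j \<in> J" and R: "norm (s (x j)) \<le> R"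
      and H: "(\<Sum>j\<in>J. norm (s (x j))) \<le> B * card J"
        "\<And>u. norm u = 1 \<Longrightarrow> \<exists>m\<in>F. a * card J \<le> (\<Sum>j\<in>J. (m - s (x j)) \<bullet> u)"
    have ne: "J - {j} \<noteq> {}"
      using J by (metis card.empty card_Diff_singleton max.boundedE Suc_1 diff_is_0_eq not_less_eq_eq)
    have "(\<integral>\<^sup>+\<theta>. joint x J \<theta> * indicator (cball 0 \<rho>) \<theta> \<partial>lborel)
        \<le> (\<integral>\<^sup>+\<theta>. ennreal (exp K) * joint x (J - {j}) \<theta> \<partial>lborel)"
    proof (rule nn_integral_mono)
      fix \<theta>
      show "joint x J \<theta> * indicator (cball 0 \<rho>) \<theta> \<le> ennreal (exp K) * joint x (J - {j}) \<theta>"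
      proof (cases "\<theta> \<in> Th \<and> \<theta> \<in> cball 0 \<rho>")
        case True
        then have "norm \<theta> \<le> \<rho>" "\<theta> \<in> Th" by auto
        have "\<theta> \<bullet> s (x j) \<le> \<rho> * R"
          using \<open>norm \<theta> \<le> \<rho>\<close> R by (intro order_trans[OF norm_cauchy_schwarz] mult_mono) (use \<rho> in auto)
        moreover have "- (m \<bullet> \<theta>) \<le> norm m * \<rho>"
          using \<open>norm \<theta> \<le> \<rho>\<close> norm_cauchy_schwarz[of "- m" \<theta>] mult_left_mono[of "norm \<theta>" \<rho> "norm m"] by auto
        ultimately have "dens \<theta> (x j) \<le> exp K"
          using C[OF \<open>\<theta> \<in> Th\<close>] by (simp add: expfam_density_def K_def)
        have nonneg: "(\<Prod>i\<in>J - {j}. dens \<theta> (x i)) * prior \<theta> \<ge> 0"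
          using dens_pos prior_nonneg by (intro mult_nonneg_nonneg prod_nonneg) (auto intro: less_imp_le)
        have "joint x J \<theta> = ennreal (dens \<theta> (x j) * ((\<Prod>i\<in>J - {j}. dens \<theta> (x i)) * prior \<theta>))"
          using \<open>\<theta> \<in> Th\<close> J by (simp add: joint_def prod.remove[of J j] mult.assoc)
        also have "\<dots> \<le> ennreal (exp K * ((\<Prod>i\<in>J - {j}. dens \<theta> (x i)) * prior \<theta>))"
          using \<open>dens \<theta> (x j) \<le> exp K\<close> nonneg by (intro ennreal_leI mult_right_mono)
        also have "\<dots> = ennreal (exp K) * joint x (J - {j}) \<theta>"
          using \<open>\<theta> \<in> Th\<close> nonneg by (simp add: joint_def ennreal_mult)
        finally show ?thesis using True by simp
      qed (auto simp: joint_def indicator_def)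
    qed
    also have "\<dots> = ennreal (exp K) * marginal lam s \<xi> \<nu> x (J - {j})"
      using ne by (simp add: nn_integral_cmult marginal_eq)
    finally have "marginal lam s \<xi> \<nu> x J \<le> 2 * (ennreal (exp K) * marginal lam s \<xi> \<nu> x (J - {j}))"
      using conc[OF J(1) _ H] J by (meson max.boundedE mult_left_mono order_trans zero_le)
    also have "\<dots> = ennreal (c * b) * marginal lam s \<xi> \<nu> x (J - {j})"
      using b by (simp add: c_def ennreal_mult mult.assoc)
    also have "\<dots> = ennreal c * marginal lam s \<xi> \<nu> x (J - {j}) * ennreal b"
      using b \<open>c \<ge> 0\<close> by (simp add: ennreal_mult mult_ac)
    also have "\<dots> \<le> ennreal c * marginal lam s \<xi> \<nu> x (J - {j}) * marginal lam s \<xi> \<nu> x {j}"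
      using b R by (intro mult_left_mono) auto
    finally show "marginal lam s \<xi> \<nu> x J
        \<le> ennreal c * marginal lam s \<xi> \<nu> x (J - {j}) * marginal lam s \<xi> \<nu> x {j}" .
  qed
qed

end

section \<open>Partitions\<close>

text \<open>Makes the \<open>Min\<close> in \<open>phi\<close> a true minimum. The witness consists
  of \<open>t - 1\<close> singletons and one part holding the remaining indices.\<close>

lemma ordered_partitions_nonempty:
  assumes "t \<ge> 1" "t \<le> n"
  shows "ordered_partitions t n \<noteq> {}"
proof -
  define A where "A = (\<lambda>l\<in>{1..t}. if l < t then {l} else {t..n})"
  have "(\<Union>l\<in>{1..t}. A l) = {1..n}"
  proof (intro equalityI subsetI)
    fix j assume "j \<in> {1..n}"
    then have "j \<in> A (min j t)" "min j t \<in> {1..t}" using assms by (auto simp: A_def min_def)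
    then show "j \<in> (\<Union>l\<in>{1..t}. A l)" by blast
  qed (use assms in \<open>auto simp: A_def split: if_splits\<close>)
  moreover have "A \<in> {1..t} \<rightarrow>\<^sub>E Pow {1..n}"
    using assms by (auto simp: A_def PiE_def Pi_def extensional_def)
  ultimately have "A \<in> ordered_partitions t n"
    using assms by (auto simp: ordered_partitions_def A_def disjoint_family_on_def)
  then show ?thesis by blast
qed

lemma finite_ordered_partitions: "finite (ordered_partitions t n)"
  by (rule finite_subset[of _ "{1..t} \<rightarrow>\<^sub>E Pow {1..n}"])
    (auto simp: ordered_partitions_def intro!: finite_PiE)

text \<open>Pigeonhole principle, stated without division to stay in the natural numbers.\<close>

lemma ordered_partition_large_part:
  assumes "A \<in> ordered_partitions t n" "t \<ge> 1"
  obtains l where "l \<in> {1..t}" "A l \<subseteq> {1..n}" "n \<le> t * card (A l)"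
proof -
  have A: "(\<Union>l\<in>{1..t}. A l) = {1..n}" using assms by (simp add: ordered_partitions_def)
  have "\<exists>l\<in>{1..t}. n \<le> t * card (A l)"
  proof (rule ccontr)
    assume "\<not> (\<exists>l\<in>{1..t}. n \<le> t * card (A l))"
    then have "(\<Sum>l\<in>{1..t}. t * card (A l)) < (\<Sum>l\<in>{1..t}. n)"
      using assms by (intro sum_strict_mono) (auto simp: not_le)
    then have "t * (\<Sum>l\<in>{1..t}. card (A l)) < t * n" by (simp add: sum_distrib_left)
    moreover have "n \<le> (\<Sum>l\<in>{1..t}. card (A l))"
      using card_UN_le[of "{1..t}" A] A by simp
    ultimately show False by simp
  qed
  then show ?thesis using A that by blast
qed

section \<open>A positive lower bound uniform over all partitions\<close>

theorem theorem6p2: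
  fixes XX :: "(real^'d) set"
    and lam P :: "(real^'d) measure"
    and s :: "real^'d \<Rightarrow> real^'k"
    and \<xi> :: "real^'k" and \<nu> :: real
    and Om :: "'w measure" and X :: "nat \<Rightarrow> 'w \<Rightarrow> real^'d"
    and t :: nat
  assumes expfam: "well_behaved_expfam XX lam s"
    and nu_pos: "\<nu> > 0"
    and prior_mean: "\<xi> /\<^sub>R \<nu> \<in> moment_space lam s"
    and marginal_finite:
      "\<And>n J x. J \<subseteq> {1..n} \<Longrightarrow> (\<And>j. j \<in> J \<Longrightarrow> x j \<in> XX) \<Longrightarrow> marginal lam s \<xi> \<nu> x J < \<infinity>"
    and P_prob: "prob_space P"
    and P_sets: "sets P = sets (restrict_space borel XX)"
    and cond1: "integrable P (\<lambda>x. norm (s x))"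
    and cond2: "measure P {x \<in> space P. s x \<in> closure (moment_space lam s)} = 1"
    and cond3: "\<And>L. hyperplane L \<Longrightarrow> L \<inter> moment_space lam s = {} \<Longrightarrow>
                  measure P {x \<in> space P. s x \<in> L} = 0"
    and Om_prob: "prob_space Om"
    and X_indep: "prob_space.indep_vars Om (\<lambda>_. P) X {1..}"
    and X_distr: "\<And>i. i \<ge> 1 \<Longrightarrow> distr Om P (X i) = P"
    and t_pos: "t \<ge> 1"
  shows "AE w in Om.
    (SUP c\<in>{0..}. liminf (\<lambda>n. ereal (phi (marginal lam s \<xi> \<nu> (\<lambda>j. X j w)) t n c))) > 0"
proof -
  interpret P: prob_space P by (rule P_prob)
  interpret Om: prob_space Om by (rule Om_prob)
  interpret exponential_family_prior XX lam s \<xi> \<nu>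
    by unfold_locales (use expfam nu_pos marginal_finite in auto)
  interpret iid_exponential_family_sample XX lam s P Om X
    by unfold_locales (use P_sets cond1 cond2 cond3 X_indep X_distr in auto)
  define E where "E = (\<integral>x. norm (s x) \<partial>P)"
  \<comment> \<open>By Markov's inequality the norm exceeds \<open>R\<close> with probability below
    \<open>1 / (4 * t)\<close>; the factor 2 in the law of large numbers turns this into a
    proportion of at most \<open>1 / (2 * t)\<close>.\<close>
  define R where "R = 4 * t * (E + 1)"
  have "E \<ge> 0" by (simp add: E_def)
  then have "R > 0" using t_pos by (simp add: R_def)
  define f where "f x = (if norm (s x) \<le> R then 0 else 1 :: real)" for x
  have f_le: "f x \<le> norm (s x) / R" and f_nonneg: "f x \<ge> 0" for x
    using \<open>R > 0\<close> by (auto simp: f_def)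
  have f_meas: "f \<in> borel_measurable P" unfolding f_def by measurable
  have f_int: "integrable P f"
    using f_meas f_nonneg by (intro P.integrable_const_bound[of _ 1]) (auto simp: f_def)
  have "(\<integral>x. f x \<partial>P) \<le> (\<integral>x. norm (s x) / R \<partial>P)"
    using f_int cond1 f_le by (intro integral_mono) auto
  also have "\<dots> = E / R" by (simp add: E_def)
  also have "\<dots> < 1 / (4 * t)" unfolding pos_divide_less_eq[OF \<open>R > 0\<close>] using t_pos by (simp add: R_def)
  finally have f_mean: "2 * (\<integral>x. f x \<partial>P) < 1 / (2 * t)" using t_pos by (simp add: field_simps)
  \<comment> \<open>A part with at least \<open>n / t\<close> elements has a mean norm of at most
    \<open>t\<close> times the mean over \<open>{1..n}\<close>, which is eventually at most
    \<open>2 * E + 1\<close>.\<close>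
  define B where "B = t * (2 * E + 1)"
  have "B \<ge> 0" using \<open>E \<ge> 0\<close> by (simp add: B_def)
  have "1 / real t > 0" using t_pos by simp
  obtain F and a :: real where F: "finite F" "F \<subseteq> Mom" and "a > 0"
    and AE_dom: "AE w in Om. \<forall>\<^sub>F n in sequentially. \<forall>J\<subseteq>{1..n}. 1 / t * n \<le> card J \<longrightarrow>
       (\<forall>u. norm u = 1 \<longrightarrow> (\<exists>m\<in>F. a * card J \<le> (\<Sum>j\<in>J. (m - s (X j w)) \<bullet> u)))"
    using AE_moments_dominate_subset_means[OF \<open>1 / real t > 0\<close>] .
  obtain c :: real and N :: nat where "c \<ge> 0" and marginal_le:
    "\<And>x J j. \<lbrakk>finite J; N \<le> card J; j \<in> J; norm (s (x j)) \<le> R;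
       (\<Sum>j\<in>J. norm (s (x j))) \<le> B * card J;
       \<And>u. norm u = 1 \<Longrightarrow> \<exists>m\<in>F. a * card J \<le> (\<Sum>j\<in>J. (m - s (x j)) \<bullet> u)\<rbrakk> \<Longrightarrow>
       marginal lam s \<xi> \<nu> x J \<le> ennreal c * marginal lam s \<xi> \<nu> x (J - {j}) * marginal lam s \<xi> \<nu> x {j}"
    using marginal_le_marginal_remove[OF F \<open>a > 0\<close> \<open>B \<ge> 0\<close>, where R = R] by blast
  have AE_norm: "AE w in Om. \<forall>\<^sub>F n in sequentially.
      (\<Sum>j\<in>{1..n}. norm (s (X j w))) \<le> n * (2 * E + 1)"
    by (rule AE_eventually_sum_le) (use cond1 in \<open>auto simp: E_def\<close>)
  have AE_f: "AE w in Om. \<forall>\<^sub>F n in sequentially. (\<Sum>j\<in>{1..n}. f (X j w)) \<le> n * (1 / (2 * t))"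
    by (rule AE_eventually_sum_le) (use f_int f_nonneg f_mean in auto)
  show ?thesis
    using AE_dom AE_norm AE_f
  proof eventually_elim
    case (elim w)
    define m where "m = marginal lam s \<xi> \<nu> (\<lambda>j. X j w)"
    have "\<forall>\<^sub>F n in sequentially. ereal (1 / (2 * t)) \<le> ereal (phi m t n c)"
      using elim eventually_ge_at_top[of "t * max 1 N"]
    proof eventually_elim
      case (elim n)
      \<comment> \<open>The 1 gives \<open>t \<le> n\<close>, so that partitions exist; the
        \<open>N\<close> ensures that a part with at least \<open>n / t\<close> elements has at
        least \<open>N\<close>.\<close>
      have "t * 1 \<le> t * max 1 N" "t * N \<le> t * max 1 N" by (intro mult_left_mono; simp)+
      with elim have n: "t \<le> n" "t * N \<le> n" by linarith+
      have "1 / (2 * t) \<le> card (S_set m t n A c) / n" if A: "A \<in> ordered_partitions t n" for A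
      proof -
        obtain l where l: "l \<in> {1..t}" "A l \<subseteq> {1..n}" "n \<le> t * card (A l)"
          using ordered_partition_large_part[OF A t_pos] .
        have fin: "finite (A l)" using l finite_subset by blast
        have "real n \<le> real t * card (A l)" using l by (simp flip: of_nat_mult)
        then have card_ge: "1 / t * n \<le> card (A l)" using t_pos by (simp add: field_simps)
        have "N \<le> card (A l)"
          using n(2) l(3) t_pos by (metis le_trans mult_le_cancel1 not_one_le_zero not_gr_zero)
        have sum_le: "(\<Sum>j\<in>A l. norm (s (X j w))) \<le> B * card (A l)"
        proof -
          have "(\<Sum>j\<in>A l. norm (s (X j w))) \<le> (\<Sum>j\<in>{1..n}. norm (s (X j w)))"
            using l by (intro sum_mono2) auto
          also have "\<dots> \<le> n * (2 * E + 1)" using elim by blast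
          also have "\<dots> \<le> (t * card (A l)) * (2 * E + 1)"
            using l \<open>E \<ge> 0\<close> by (intro mult_right_mono) (auto simp flip: of_nat_mult)
          finally show ?thesis by (simp add: B_def mult_ac)
        qed
        have dom: "\<exists>m\<in>F. a * card (A l) \<le> (\<Sum>j\<in>A l. (m - s (X j w)) \<bullet> u)" if "norm u = 1" for u
          using elim(1) l(2) card_ge that by blast
        have sub: "{j\<in>A l. norm (s (X j w)) \<le> R} \<subseteq> S_set m t n A c"
          using marginal_le[OF fin \<open>N \<le> card (A l)\<close> _ _ sum_le dom] l
          by (auto simp: S_set_def m_def)
        \<comment> \<open>Good indices are the at least \<open>n / t\<close> elements of the part
          minus the bad ones. The latter are counted over all of \<open>{1..n}\<close>, so the bound
          \<open>n / (2 * t)\<close> does not depend on the partition.\<close>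
        have "card (A l) - (\<Sum>j\<in>A l. f (X j w)) = (\<Sum>j\<in>A l. 1 - f (X j w))"
          by (simp add: sum_subtractf)
        also have "\<dots> = (\<Sum>j\<in>A l. if norm (s (X j w)) \<le> R then 1 else 0)"
          by (intro sum.cong) (auto simp: f_def)
        also have "\<dots> = card {j\<in>A l. norm (s (X j w)) \<le> R}"
          using fin by (simp add: sum.If_cases Int_def)
        also have "\<dots> \<le> card (S_set m t n A c)"
          using sub by (intro of_nat_mono card_mono) (auto simp: S_set_def)
        finally have "card (A l) \<le> card (S_set m t n A c) + (\<Sum>j\<in>A l. f (X j w))" by simp
        also have "(\<Sum>j\<in>A l. f (X j w)) \<le> (\<Sum>j\<in>{1..n}. f (X j w))"
          using l f_nonneg by (intro sum_mono2) auto
        also have "\<dots> \<le> n * (1 / (2 * t))" using elim by blast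
        finally have "1 / t * n - n * (1 / (2 * t)) \<le> card (S_set m t n A c)"
          using card_ge by simp
        moreover have "n > 0" using n t_pos by simp
        ultimately show ?thesis using t_pos by (simp add: field_simps)
      qed
      then show ?case
        using ordered_partitions_nonempty[OF t_pos n(1)] finite_ordered_partitions[of t n]
        by (auto simp: phi_def)
    qed
    have zero_less: "0 < ereal (1 / (2 * t))" using t_pos by simp
    have "ereal (1 / (2 * t)) \<le> liminf (\<lambda>n. ereal (phi m t n c))"
      by (rule Liminf_bounded) fact
    also have "\<dots> \<le> (SUP c\<in>{0..}. liminf (\<lambda>n. ereal (phi m t n c)))"
      using \<open>c \<ge> 0\<close> by (intro SUP_upper) auto
    finally show ?case unfolding m_def using zero_less by (rule less_le_trans[rotated])
  qed
qed

end
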